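(* Let $\delta>0$ be a (constant) parameter. There exists an algorithm that, given probe access to a $q$-spin system $\mathcal S=(G=(V,E),\boldsymbol\lambda,\boldsymbol A)$ on a graph $G$ with maximum degree $\Delta\ge 1$ and with Gibbs distribution $\mu$, satisfying (i) (normalized) $\sum_{c\in[q]}\lambda_v(c)=1$ for all $v\in V$ and $\max_{i,j\in[q]}A_e(i,j)=1$ for all $e\in E$, and (ii) (soft constraints) $A_e(c_1,c_2)\ge 1-\frac{1-\delta}{2\Delta}$ for every edge $e\in E$ and all $c_1,c_2\in[q]$, and given a subset of vertices $\Lambda\subseteq V$, outputs a perfect sample $X\sim\mu_\Lambda$ (that is, $X\in[q]^\Lambda$ is distributed exactly according to $\mu_\Lambda$) in expected time $O(\Delta\log q\cdot|\Lambda|)$.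
   Context: Let $q\ge2$ be an integer. A $q$-spin system $\mathcal S=(G=(V,E),\boldsymbol\lambda=(\lambda_v)_{v\in V},\boldsymbol A=(A_e)_{e\in E})$ is defined on a finite graph $G=(V,E)$, with an external field $\lambda_v\in\mathbb R_{\ge0}^q$ at each vertex $v$ and an interaction matrix $A_e\in\mathbb R_{\ge0}^{q\times q}$ at each edge $e$. Its Gibbs distribution on $[q]^V$ is $\mu(\sigma)=w(\sigma)/Z$, where $w(\sigma)=\prod_{v\in V}\lambda_v(\sigma(v))\prod_{e=(u,v)\in E}A_e(\sigma(u),\sigma(v))$ and $Z=\sum_{\sigma\in[q]^V}w(\sigma)$. For $\Lambda\subseteq V$, the marginal distribution $\mu_\Lambda$ is $\mu_\Lambda(\tau)=\sum_{\sigma\in[q]^V:\sigma_\Lambda=\tau}\mu(\sigma)$ for $\tau\in[q]^\Lambda$. Probe access means: for each $v\in V$, each neighbor of $v$ can be accessed in $O(1)$ time, and each entry of every $\lambda_v$ and $A_e$ can be retrieved in $O(1)$ time.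
   Formalization: Besides O(1) probes of entries, the algorithm may draw a colour from a given λ_v at cost log q; with entry probes alone the bound fails (A=1, λ_v a point mass at an unknown colour needs about q/2 probes). Coins of computed real bias cost O(1), and |Λ| is read as max(1,|Λ|). *)

theory Defs
  imports "HOL-Probability.Probability"
begin

section \<open>Spin systems\<close>

text \<open>
  A finite simple graph is given by its vertex names, which are natural numbers, and its edges,
  each listed as an ordered pair \<open>(u, v)\<close> in exactly one orientation. The orientation only fixes
  which argument of the (not necessarily symmetric) matrix \<open>A\<^sub>e\<close> belongs to which endpoint.
  The colour set \<open>[q]\<close> is \<open>{..<q}\<close>.
\<close>

record spin_system =
  spins :: nat
  verts :: "nat set"
  edges :: "(nat \<times> nat) set"
  ext_field :: "nat \<Rightarrow> nat \<Rightarrow> real"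
  interaction :: "nat \<times> nat \<Rightarrow> nat \<Rightarrow> nat \<Rightarrow> real"

definition wf_spin_system :: "spin_system \<Rightarrow> bool" where
  "wf_spin_system S \<longleftrightarrow>
     spins S \<ge> 2 \<and>
     finite (verts S) \<and>
     edges S \<subseteq> verts S \<times> verts S \<and>
     (\<forall>u v. (u, v) \<in> edges S \<longrightarrow> u \<noteq> v \<and> (v, u) \<notin> edges S) \<and>
     (\<forall>v\<in>verts S. \<forall>c<spins S. ext_field S v c \<ge> 0) \<and>
     (\<forall>e\<in>edges S. \<forall>i<spins S. \<forall>j<spins S. interaction S e i j \<ge> 0)"

definition neighbours :: "spin_system \<Rightarrow> nat \<Rightarrow> nat set" where
  "neighbours S v = {u. (u, v) \<in> edges S \<or> (v, u) \<in> edges S}"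

definition degree :: "spin_system \<Rightarrow> nat \<Rightarrow> nat" where
  "degree S v = card (neighbours S v)"

text \<open>The supremum over the empty set of natural numbers is \<open>0\<close>.\<close>

definition max_degree :: "spin_system \<Rightarrow> nat" where
  "max_degree S = (SUP v\<in>verts S. degree S v)"

definition configs :: "spin_system \<Rightarrow> nat set \<Rightarrow> (nat \<Rightarrow> nat) set" where
  "configs S \<Lambda> = (\<Lambda> \<rightarrow>\<^sub>E {..<spins S})"

definition weight :: "spin_system \<Rightarrow> (nat \<Rightarrow> nat) \<Rightarrow> real" where
  "weight S \<sigma> =
     (\<Prod>v\<in>verts S. ext_field S v (\<sigma> v)) * (\<Prod>(u, v)\<in>edges S. interaction S (u, v) (\<sigma> u) (\<sigma> v))"

definition partition_function :: "spin_system \<Rightarrow> real" where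
  "partition_function S = (\<Sum>\<sigma>\<in>configs S (verts S). weight S \<sigma>)"

definition gibbs :: "spin_system \<Rightarrow> (nat \<Rightarrow> nat) \<Rightarrow> real" where
  "gibbs S \<sigma> = weight S \<sigma> / partition_function S"

definition gibbs_marginal :: "spin_system \<Rightarrow> nat set \<Rightarrow> (nat \<Rightarrow> nat) \<Rightarrow> real" where
  "gibbs_marginal S \<Lambda> \<tau> = (\<Sum>\<sigma> | \<sigma> \<in> configs S (verts S) \<and> restrict \<sigma> \<Lambda> = \<tau>. gibbs S \<sigma>)"

definition normalized :: "spin_system \<Rightarrow> bool" where
  "normalized S \<longleftrightarrow>
     (\<forall>v\<in>verts S. (\<Sum>c<spins S. ext_field S v c) = 1) \<and>
     (\<forall>e\<in>edges S. Max {interaction S e i j |i j. i < spins S \<and> j < spins S} = 1)"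

definition soft_constraints :: "real \<Rightarrow> spin_system \<Rightarrow> bool" where
  "soft_constraints \<delta> S \<longleftrightarrow>
     (\<forall>e\<in>edges S. \<forall>c1<spins S. \<forall>c2<spins S.
        interaction S e c1 c2 \<ge> 1 - (1 - \<delta>) / (2 * real (max_degree S)))"


section \<open>Randomized algorithms with probe access\<close>

text \<open>
  Algorithms are while programs on a random access machine. The memory holds natural numbers: scalar
  variables and zero-initialized arrays with two indices. The natural numbers can be added,
  subtracted (truncating) and compared. Real arithmetic occurs in comparisons and in the
  bias of a coin. A program has no access to the spin system other than the probes
  \<open>Degree v\<close> and \<open>Neighbour v i\<close> (the \<open>i\<close>-th neighbour of \<open>v\<close>), the entry probes \<open>Field v c\<close> and
  \<open>Interaction u v c d\<close> (the entry of the matrix at the edge joining \<open>u\<close> and \<open>v\<close> for colour \<open>c\<close>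
  at \<open>u\<close> and \<open>d\<close> at \<open>v\<close>), and the sampling command \<open>Draw\<close>.
\<close>

type_synonym vname = string

datatype aexp =
    N nat
  | V vname
  | Arr vname aexp aexp
  | Plus aexp aexp
  | Minus aexp aexp
  | Degree aexp
  | Neighbour aexp aexp

datatype rexp =
    R real
  | OfNat aexp
  | RPlus rexp rexp
  | RMinus rexp rexp
  | RTimes rexp rexp
  | RDivide rexp rexp
  | Field aexp aexp
  | Interaction aexp aexp aexp aexp

datatype bexp =
    Less aexp aexp
  | Eq aexp aexp
  | RLess rexp rexp
  | Not bexp
  | And bexp bexp

text \<open>
  \<open>Flip x r\<close> tosses a coin with bias \<open>r\<close> (clamped to the unit interval), that is, it compares a fresh
  uniform real number from the unit interval with \<open>r\<close>. \<open>Draw x v\<close> draws a colour from the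
  distribution \<open>\<lambda>\<^sub>v\<close>.
\<close>

datatype com =
    Skip
  | Assign vname aexp
  | Store vname aexp aexp aexp
  | Flip vname rexp
  | Draw vname aexp
  | Seq com com
  | If bexp com com
  | While bexp com

record state =
  scalars :: "vname \<Rightarrow> nat"
  arrays :: "vname \<Rightarrow> nat \<Rightarrow> nat \<Rightarrow> nat"

text \<open>
  The adjacency lists \<open>adj\<close> represent the graph to the algorithm; neighbours may be listed in any
  order.
\<close>

definition adjacency_lists :: "spin_system \<Rightarrow> (nat \<Rightarrow> nat list) \<Rightarrow> bool" where
  "adjacency_lists S adj \<longleftrightarrow>
     (\<forall>v\<in>verts S. distinct (adj v) \<and> set (adj v) = neighbours S v)"

definition interaction_probe :: "spin_system \<Rightarrow> nat \<Rightarrow> nat \<Rightarrow> nat \<Rightarrow> nat \<Rightarrow> real" where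
  "interaction_probe S u v c d =
     (if (u, v) \<in> edges S then interaction S (u, v) c d
      else if (v, u) \<in> edges S then interaction S (v, u) d c
      else 0)"

definition field_pmf :: "spin_system \<Rightarrow> nat \<Rightarrow> nat pmf" where
  "field_pmf S v =
     (if v \<in> verts S then embed_pmf (\<lambda>c. if c < spins S then ext_field S v c else 0)
      else return_pmf 0)"

fun aval :: "(nat \<Rightarrow> nat list) \<Rightarrow> aexp \<Rightarrow> state \<Rightarrow> nat" where
  "aval adj (N n) s = n"
| "aval adj (V x) s = scalars s x"
| "aval adj (Arr x a b) s = arrays s x (aval adj a s) (aval adj b s)"
| "aval adj (Plus a b) s = aval adj a s + aval adj b s"
| "aval adj (Minus a b) s = aval adj a s - aval adj b s"
| "aval adj (Degree a) s = length (adj (aval adj a s))"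
| "aval adj (Neighbour a b) s =
     (let l = adj (aval adj a s); i = aval adj b s in if i < length l then l ! i else 0)"

fun rval :: "spin_system \<Rightarrow> (nat \<Rightarrow> nat list) \<Rightarrow> rexp \<Rightarrow> state \<Rightarrow> real" where
  "rval S adj (R r) s = r"
| "rval S adj (OfNat a) s = real (aval adj a s)"
| "rval S adj (RPlus a b) s = rval S adj a s + rval S adj b s"
| "rval S adj (RMinus a b) s = rval S adj a s - rval S adj b s"
| "rval S adj (RTimes a b) s = rval S adj a s * rval S adj b s"
| "rval S adj (RDivide a b) s = rval S adj a s / rval S adj b s"
| "rval S adj (Field a b) s = ext_field S (aval adj a s) (aval adj b s)"
| "rval S adj (Interaction a b c d) s =
     interaction_probe S (aval adj a s) (aval adj b s) (aval adj c s) (aval adj d s)"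

fun bval :: "spin_system \<Rightarrow> (nat \<Rightarrow> nat list) \<Rightarrow> bexp \<Rightarrow> state \<Rightarrow> bool" where
  "bval S adj (Less a b) s \<longleftrightarrow> aval adj a s < aval adj b s"
| "bval S adj (Eq a b) s \<longleftrightarrow> aval adj a s = aval adj b s"
| "bval S adj (RLess a b) s \<longleftrightarrow> rval S adj a s < rval S adj b s"
| "bval S adj (Not b) s \<longleftrightarrow> \<not> bval S adj b s"
| "bval S adj (And a b) s \<longleftrightarrow> bval S adj a s \<and> bval S adj b s"

definition set_scalar :: "vname \<Rightarrow> nat \<Rightarrow> state \<Rightarrow> state" where
  "set_scalar x n s = s\<lparr>scalars := (scalars s)(x := n)\<rparr>"

definition set_array :: "vname \<Rightarrow> nat \<Rightarrow> nat \<Rightarrow> nat \<Rightarrow> state \<Rightarrow> state" where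
  "set_array x i j n s =
     s\<lparr>arrays := (arrays s)(x := (arrays s x)(i := (arrays s x i)(j := n)))\<rparr>"

text \<open>
  A machine configuration consists of the list of commands still to be executed, which is empty
  when the machine has halted, and the memory state. Execution is a Markov chain on configurations.
\<close>

type_synonym machine = "com list \<times> state"

fun step :: "spin_system \<Rightarrow> (nat \<Rightarrow> nat list) \<Rightarrow> machine \<Rightarrow> machine pmf" where
  "step S adj ([], s) = return_pmf ([], s)"
| "step S adj (Skip # k, s) = return_pmf (k, s)"
| "step S adj (Assign x a # k, s) = return_pmf (k, set_scalar x (aval adj a s) s)"
| "step S adj (Store x a b e # k, s) =
     return_pmf (k, set_array x (aval adj a s) (aval adj b s) (aval adj e s) s)"
| "step S adj (Flip x r # k, s) =
     map_pmf (\<lambda>b. (k, set_scalar x (if b then 1 else 0) s)) (bernoulli_pmf (rval S adj r s))"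
| "step S adj (Draw x a # k, s) =
     map_pmf (\<lambda>c. (k, set_scalar x c s)) (field_pmf S (aval adj a s))"
| "step S adj (Seq c1 c2 # k, s) = return_pmf (c1 # c2 # k, s)"
| "step S adj (If b c1 c2 # k, s) = return_pmf ((if bval S adj b s then c1 else c2) # k, s)"
| "step S adj (While b c # k, s) =
     return_pmf (if bval S adj b s then c # While b c # k else k, s)"

text \<open>
  The expressions of a fixed program have bounded size, so that evaluating one takes constant
  time. Drawing from a given distribution on \<open>q\<close> colours takes time \<open>log q\<close>.
\<close>

fun step_cost :: "spin_system \<Rightarrow> machine \<Rightarrow> real" where
  "step_cost S ([], s) = 0"
| "step_cost S (Draw x a # k, s) = log 2 (real (spins S))"
| "step_cost S (c # k, s) = 1"

definition input_state :: "spin_system \<Rightarrow> nat list \<Rightarrow> state" where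
  "input_state S xs =
     \<lparr>scalars = (\<lambda>_. 0)(''q'' := spins S, ''m'' := length xs),
      arrays = (\<lambda>_ _ _. 0)
        (''input'' := (\<lambda>i j. if i < length xs \<and> j = 0 then xs ! i else 0))\<rparr>"

definition output_config :: "nat set \<Rightarrow> state \<Rightarrow> nat \<Rightarrow> nat" where
  "output_config \<Lambda> s = restrict (\<lambda>v. arrays s ''output'' v 0) \<Lambda>"

primrec run :: "com \<Rightarrow> spin_system \<Rightarrow> (nat \<Rightarrow> nat list) \<Rightarrow> nat list \<Rightarrow> nat \<Rightarrow> machine pmf" where
  "run P S adj xs 0 = return_pmf ([P], input_state S xs)"
| "run P S adj xs (Suc n) = bind_pmf (run P S adj xs n) (step S adj)"

text \<open>
  Halted configurations are absorbing, so the probabilities below increase with \<open>n\<close> and their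
  supremum is the probability that the program ever halts with output \<open>\<tau>\<close>.
\<close>

definition output_prob ::
  "com \<Rightarrow> spin_system \<Rightarrow> (nat \<Rightarrow> nat list) \<Rightarrow> nat list \<Rightarrow> (nat \<Rightarrow> nat) \<Rightarrow> real" where
  "output_prob P S adj xs \<tau> =
     (SUP n. measure_pmf.prob (run P S adj xs n)
        {(k, s). k = [] \<and> output_config (set xs) s = \<tau>})"

definition expected_time ::
  "com \<Rightarrow> spin_system \<Rightarrow> (nat \<Rightarrow> nat list) \<Rightarrow> nat list \<Rightarrow> ennreal" where
  "expected_time P S adj xs =
     (\<Sum>n. \<integral>\<^sup>+ x. ennreal (step_cost S x) \<partial>measure_pmf (run P S adj xs n))"

end

theory Submission
  imports Defs
begin

text \<open>
  To sample the spin of a vertex \<open>w\<close> given pinned spins, propose a colour \<open>c\<close> from \<open>\<lambda>\<^sub>w\<close> and accept it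
  with probability \<open>\<Prod>\<^sub>u A(c, \<sigma>\<^sub>u)\<close>, where \<open>\<sigma>\<close> is drawn from the system with \<open>w\<close> deleted; on rejection
  start afresh. This is exact, because the marginal at \<open>w\<close> is proportional to \<open>\<lambda>\<^sub>w(c)\<close> times the mean of
  the product. Each factor is at least \<open>1 - p\<close> with \<open>p = (1 - \<delta>) / (2 deg w)\<close>, so the spin \<open>\<sigma>\<^sub>u\<close> needs
  to be known only with probability \<open>p\<close>, in which case it is sampled recursively and pinned. An
  attempt makes at most \<open>(1 - \<delta>) / 2\<close> recursive calls on average and succeeds with probability at least
  \<open>(1 + \<delta>) / 2\<close>; the difference \<open>\<delta>\<close> makes the branching subcritical, so a call costs
  \<open>O((\<Delta> + log q) / \<delta>)\<close>.

  Both claims are proved by exhibiting one superharmonic function on machine states, the exact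
  conditional expectation of a function of the output plus \<open>\<kappa>\<close> times a bound on the remaining time.
  The choice \<open>\<kappa> = 1\<close> bounds the time; \<open>\<kappa> = 0\<close> bounds the output probabilities from above, and since
  the program halts almost surely these bounds are equalities.
\<close>

section \<open>Expected cost of programs\<close>

text \<open>An expectation transformer: \<open>F\<close> values the memory handed to the remaining
  commands and \<open>\<kappa>\<close> is the price of one unit of time. The least fixed point for
  loops makes every loop bound valid without a separate termination argument.\<close>

primrec expected_cost ::
  "spin_system \<Rightarrow> (nat \<Rightarrow> nat list) \<Rightarrow> ennreal \<Rightarrow> com \<Rightarrow> (state \<Rightarrow> ennreal) \<Rightarrow> state \<Rightarrow> ennreal"
where
  "expected_cost S adj \<kappa> Skip F = (\<lambda>s. \<kappa> + F s)"
| "expected_cost S adj \<kappa> (Assign x a) F = (\<lambda>s. \<kappa> + F (set_scalar x (aval adj a s) s))"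
| "expected_cost S adj \<kappa> (Store x a b e) F =
     (\<lambda>s. \<kappa> + F (set_array x (aval adj a s) (aval adj b s) (aval adj e s) s))"
| "expected_cost S adj \<kappa> (Flip x r) F =
     (\<lambda>s. \<kappa> + (\<integral>\<^sup>+ b. F (set_scalar x (if b then 1 else 0) s) \<partial>bernoulli_pmf (rval S adj r s)))"
| "expected_cost S adj \<kappa> (Draw x a) F =
     (\<lambda>s. \<kappa> * ennreal (log 2 (real (spins S))) +
        (\<integral>\<^sup>+ c. F (set_scalar x c s) \<partial>field_pmf S (aval adj a s)))"
| "expected_cost S adj \<kappa> (Seq c1 c2) F =
     (\<lambda>s. \<kappa> + expected_cost S adj \<kappa> c1 (expected_cost S adj \<kappa> c2 F) s)"
| "expected_cost S adj \<kappa> (If b c1 c2) F =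
     (\<lambda>s. \<kappa> + (if bval S adj b s then expected_cost S adj \<kappa> c1 F s else expected_cost S adj \<kappa> c2 F s))"
| "expected_cost S adj \<kappa> (While b c) F =
     lfp (\<lambda>X s. \<kappa> + (if bval S adj b s then expected_cost S adj \<kappa> c X s else F s))"

lemma expected_cost_mono:
  "F \<le> G \<Longrightarrow> expected_cost S adj \<kappa> c F \<le> expected_cost S adj \<kappa> c G"
proof (induction c arbitrary: F G)
  case (While b c)
  show ?case unfolding expected_cost.simps
    by (rule lfp_mono) (use While.prems in \<open>auto simp: le_fun_def intro!: add_left_mono\<close>)
next
  case (Seq c1 c2)
  show ?case using Seq.IH(1)[OF Seq.IH(2)[OF Seq.prems]] by (auto simp: le_fun_def intro!: add_left_mono)
next
  case (If b c1 c2)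
  show ?case using If.IH(1)[OF If.prems] If.IH(2)[OF If.prems]
    by (auto simp: le_fun_def intro!: add_left_mono)
qed (auto simp: le_fun_def intro!: add_left_mono nn_integral_mono)

lemma expected_cost_While_unfold:
  "expected_cost S adj \<kappa> (While b c) F s =
     \<kappa> + (if bval S adj b s then expected_cost S adj \<kappa> c (expected_cost S adj \<kappa> (While b c) F) s
          else F s)"
proof -
  have "mono (\<lambda>X s. \<kappa> + (if bval S adj b s then expected_cost S adj \<kappa> c X s else F s))"
    by (rule monoI) (use expected_cost_mono in \<open>auto simp: le_fun_def intro!: add_left_mono\<close>)
  from lfp_unfold[OF this] show ?thesis
    by (simp only: expected_cost.simps) (metis (no_types, lifting))
qed

text \<open>Park induction: a function that dominates its own image under the loop functional lies
  above the least fixed point.\<close>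

lemma expected_cost_While_le:
  assumes "\<And>s. bval S adj b s \<Longrightarrow> \<kappa> + expected_cost S adj \<kappa> c I s \<le> I s"
    and "\<And>s. \<not> bval S adj b s \<Longrightarrow> \<kappa> + F s \<le> I s"
  shows "expected_cost S adj \<kappa> (While b c) F s \<le> I s"
proof -
  have "expected_cost S adj \<kappa> (While b c) F \<le> I"
    unfolding expected_cost.simps by (rule lfp_lowerbound) (use assms in \<open>auto simp: le_fun_def\<close>)
  then show ?thesis by (simp add: le_fun_def)
qed

text \<open>The command list acts as a continuation, so folding over it extends the transformer from
  programs to machine configurations.\<close>

definition machine_cost ::
  "spin_system \<Rightarrow> (nat \<Rightarrow> nat list) \<Rightarrow> ennreal \<Rightarrow> (state \<Rightarrow> ennreal) \<Rightarrow> machine \<Rightarrow> ennreal"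
where
  "machine_cost S adj \<kappa> F x = foldr (expected_cost S adj \<kappa>) (fst x) F (snd x)"

text \<open>Exact harmonicity in one step. Only loops need the fixed point equation; the other
  commands agree by definition.\<close>

lemma machine_cost_step:
  "\<kappa> * ennreal (step_cost S x) + (\<integral>\<^sup>+ y. machine_cost S adj \<kappa> F y \<partial>step S adj x)
     = machine_cost S adj \<kappa> F x"
proof -
  obtain k s where x: "x = (k, s)" by (cases x)
  show ?thesis
  proof (cases k)
    case Nil
    then show ?thesis by (simp add: x machine_cost_def)
  next
    case (Cons c k')
    show ?thesis
    proof (cases c)
      case (While b c')
      then show ?thesis
        using expected_cost_While_unfold[of S adj \<kappa> b c' "foldr (expected_cost S adj \<kappa>) k' F" s]
        by (simp add: x Cons machine_cost_def del: expected_cost.simps(8))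
    qed (simp_all add: x Cons machine_cost_def)
  qed
qed

text \<open>The one-step equation telescopes: the cost paid so far plus the expected remaining cost
  is conserved.\<close>

lemma machine_cost_run:
  "(\<Sum>i<n. \<kappa> * (\<integral>\<^sup>+ x. ennreal (step_cost S x) \<partial>run P S adj xs i)) +
     (\<integral>\<^sup>+ x. machine_cost S adj \<kappa> F x \<partial>run P S adj xs n)
   = expected_cost S adj \<kappa> P F (input_state S xs)"
proof (induction n)
  case 0
  show ?case by (simp add: machine_cost_def)
next
  case (Suc n)
  have "\<kappa> * (\<integral>\<^sup>+ x. ennreal (step_cost S x) \<partial>run P S adj xs n) +
     (\<integral>\<^sup>+ x. machine_cost S adj \<kappa> F x \<partial>run P S adj xs (Suc n)) =
     (\<integral>\<^sup>+ x. machine_cost S adj \<kappa> F x \<partial>run P S adj xs n)"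
    by (simp add: nn_integral_cmult[symmetric] nn_integral_add[symmetric] machine_cost_step)
  then show ?case using Suc.IH by (simp add: add.assoc)
qed

lemma expected_time_le:
  "expected_time P S adj xs \<le> expected_cost S adj 1 P (\<lambda>_. 0) (input_state S xs)"
  unfolding expected_time_def
proof (rule suminf_le_const)
  fix n
  show "(\<Sum>i<n. \<integral>\<^sup>+ x. ennreal (step_cost S x) \<partial>run P S adj xs i)
      \<le> expected_cost S adj 1 P (\<lambda>_. 0) (input_state S xs)"
    using machine_cost_run[where \<kappa> = 1 and F = "\<lambda>_. 0"] by (metis (no_types, lifting) le_iff_add mult_1 sum.cong)
qed simp

text \<open>On halted configurations \<open>machine_cost\<close> is \<open>F\<close> of the memory;
  the nonnegative contribution of the others is discarded.\<close>

lemma halted_expectation_le: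
  "(\<integral>\<^sup>+ x. (if fst x = [] then F (snd x) else 0) \<partial>run P S adj xs n)
     \<le> expected_cost S adj 0 P F (input_state S xs)"
proof -
  have "(\<integral>\<^sup>+ x. (if fst x = [] then F (snd x) else 0) \<partial>run P S adj xs n)
     \<le> (\<integral>\<^sup>+ x. machine_cost S adj 0 F x \<partial>run P S adj xs n)"
    by (intro nn_integral_mono) (auto simp: machine_cost_def)
  then show ?thesis using machine_cost_run[where \<kappa> = 0] by simp
qed

section \<open>Almost sure halting and exact output probabilities\<close>

lemma step_cost_ge_1:
  assumes "spins S \<ge> 2" "k \<noteq> []"
  shows "step_cost S (k, s) \<ge> 1"
proof (cases k)
  case (Cons c k')
  have "log 2 (real (spins S)) \<ge> log 2 2" using assms by (subst log_le_cancel_iff) auto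
  then show ?thesis using Cons by (cases c) auto
qed (use assms in auto)

text \<open>Each step of a running machine costs at least 1, so a finite expected time makes the
  probabilities of still running summable.\<close>

lemma not_halted_tendsto_0:
  assumes "spins S \<ge> 2" "expected_time P S adj xs < \<infinity>"
  shows "(\<lambda>n. measure_pmf.prob (run P S adj xs n) {x. fst x \<noteq> []}) \<longlonglongrightarrow> 0"
proof -
  let ?p = "\<lambda>n. measure_pmf.prob (run P S adj xs n) {x. fst x \<noteq> []}"
  have le: "ennreal (?p n) \<le> (\<integral>\<^sup>+ x. ennreal (step_cost S x) \<partial>run P S adj xs n)" for n
  proof -
    have "ennreal (?p n) = (\<integral>\<^sup>+ x. indicator {x. fst x \<noteq> []} x \<partial>run P S adj xs n)"
      by (simp add: measure_pmf.emeasure_eq_measure)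
    also have "\<dots> \<le> (\<integral>\<^sup>+ x. ennreal (step_cost S x) \<partial>run P S adj xs n)"
      using step_cost_ge_1[OF assms(1)]
      by (intro nn_integral_mono)
        (auto simp: indicator_def ennreal_1[symmetric] simp del: ennreal_1 intro!: ennreal_leI)
    finally show ?thesis .
  qed
  have "(\<Sum>n. ennreal (?p n)) \<le> expected_time P S adj xs"
    unfolding expected_time_def by (intro suminf_le le) auto
  then have "(\<Sum>n. ennreal (?p n)) \<noteq> \<top>" using assms(2) by (auto simp: top_unique)
  then have "summable ?p" by (intro summable_suminf_not_top) auto
  then show ?thesis by (rule summable_LIMSEQ_zero)
qed

text \<open>
  Upper bounds on the output probabilities of an event and of its complement are enough: for a
  program that halts almost surely they leave no slack.
\<close>

lemma output_prob_eqI: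
  assumes q: "spins S \<ge> 2" and fin: "expected_time P S adj xs < \<infinity>"
    and le: "expected_cost S adj 0 P (\<lambda>s. of_bool (output_config (set xs) s = \<tau>)) (input_state S xs)
       \<le> ennreal p"
    and ge: "expected_cost S adj 0 P (\<lambda>s. of_bool (output_config (set xs) s \<noteq> \<tau>)) (input_state S xs)
       \<le> ennreal (1 - p)"
    and p: "0 \<le> p" "p \<le> 1"
  shows "output_prob P S adj xs \<tau> = p"
proof -
  let ?H = "{(k, s). k = [] \<and> output_config (set xs) s = \<tau>} :: machine set"
  let ?G = "{(k, s). k = [] \<and> output_config (set xs) s \<noteq> \<tau>} :: machine set"
  let ?N = "{x. fst x \<noteq> []} :: machine set"
  let ?M = "\<lambda>n. measure_pmf.prob (run P S adj xs n)"
  have *: "ennreal (?M n {(k, s). k = [] \<and> Q s}) \<le>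
      expected_cost S adj 0 P (\<lambda>s. of_bool (Q s)) (input_state S xs)" for n and Q :: "state \<Rightarrow> bool"
  proof -
    have "ennreal (?M n {(k, s). k = [] \<and> Q s}) =
        (\<integral>\<^sup>+ x. indicator {(k, s). k = [] \<and> Q s} x \<partial>run P S adj xs n)"
      by (simp add: measure_pmf.emeasure_eq_measure)
    also have "\<dots> = (\<integral>\<^sup>+ x. (if fst x = [] then of_bool (Q (snd x)) else 0) \<partial>run P S adj xs n)"
      by (intro nn_integral_cong) (auto simp: indicator_def)
    finally show ?thesis using halted_expectation_le by simp
  qed
  have H: "?M n ?H \<le> p" for n
    using order.trans[OF * le] p by simp
  have G: "?M n ?G \<le> 1 - p" for n
    using order.trans[OF * ge] p by simp
  have HGN: "?M n ?H + ?M n ?G + ?M n ?N = 1" for n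
  proof -
    have "?M n ?H + ?M n ?G = ?M n (?H \<union> ?G)"
      by (rule measure_pmf.finite_measure_Union[symmetric]) auto
    also have "\<dots> + ?M n ?N = ?M n (?H \<union> ?G \<union> ?N)"
      by (rule measure_pmf.finite_measure_Union[symmetric]) auto
    also have "?H \<union> ?G \<union> ?N = UNIV" by auto
    finally show ?thesis by simp
  qed
  have bdd: "bdd_above (range (\<lambda>n. ?M n ?H))" using H by (auto intro: bdd_aboveI)
  have "p - ?M n ?N \<le> output_prob P S adj xs \<tau>" for n
  proof -
    have "p - ?M n ?N \<le> ?M n ?H" using G[of n] HGN[of n] by linarith
    also have "\<dots> \<le> output_prob P S adj xs \<tau>"
      unfolding output_prob_def by (rule cSUP_upper[OF _ bdd]) simp
    finally show ?thesis .
  qed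
  moreover have "(\<lambda>n. p - ?M n ?N) \<longlonglongrightarrow> p - 0"
    by (intro tendsto_intros not_halted_tendsto_0 q fin)
  ultimately have "p - 0 \<le> output_prob P S adj xs \<tau>" by (intro LIMSEQ_le_const2) auto
  moreover have "output_prob P S adj xs \<tau> \<le> p"
    unfolding output_prob_def by (intro cSUP_least H) simp
  ultimately show ?thesis by simp
qed

section \<open>Real upper bounds for extended nonnegative expectations\<close>

definition bounded_by :: "ennreal \<Rightarrow> real \<Rightarrow> bool" where
  "bounded_by X y \<longleftrightarrow> 0 \<le> y \<and> X \<le> ennreal y"

text \<open>Read backwards, this spends \<open>a\<close> of the budget \<open>y\<close> on one
  command. The sign of the budget is carried in \<open>bounded_by\<close> because
  \<open>ennreal\<close> truncates negative reals to 0, which would hide an overdraft.\<close>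

lemma bounded_by_add: "bounded_by X (y - a) \<Longrightarrow> 0 \<le> a \<Longrightarrow> bounded_by (ennreal a + X) y"
  unfolding bounded_by_def
  by (metis add_left_mono add_nonneg_nonneg diff_add_cancel ennreal_plus add.commute)

lemma bounded_by_add_mult:
  "bounded_by X (y - a * b) \<Longrightarrow> 0 \<le> a \<Longrightarrow> 0 \<le> b \<Longrightarrow> bounded_by (ennreal a * ennreal b + X) y"
  using bounded_by_add[of X y "a * b"] by (simp add: ennreal_mult)

lemma bounded_by_bernoulli:
  assumes "bounded_by (F True) y1" "bounded_by (F False) y0" "0 \<le> p" "p \<le> 1"
    "p * y1 + (1 - p) * y0 \<le> y"
  shows "bounded_by (\<integral>\<^sup>+ b. F b \<partial>bernoulli_pmf p) y"
proof -
  have "(\<integral>\<^sup>+ b. F b \<partial>bernoulli_pmf p) = F True * ennreal p + F False * ennreal (1 - p)"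
    using assms by simp
  also have "\<dots> \<le> ennreal y1 * ennreal p + ennreal y0 * ennreal (1 - p)"
    using assms by (intro add_mono mult_right_mono) (auto simp: bounded_by_def)
  also have "\<dots> = ennreal (p * y1 + (1 - p) * y0)"
    using assms by (simp add: bounded_by_def ennreal_mult'[symmetric] mult.commute flip: ennreal_plus)
  also have "\<dots> \<le> ennreal y" using assms by (intro ennreal_leI)
  finally have "(\<integral>\<^sup>+ b. F b \<partial>bernoulli_pmf p) \<le> ennreal y" .
  moreover have "0 \<le> p * y1 + (1 - p) * y0" using assms by (simp add: bounded_by_def)
  ultimately show ?thesis using assms(5) unfolding bounded_by_def by linarith
qed

section \<open>Conditional expectations in soft spin systems\<close>

locale soft_spin_system =
  fixes S :: spin_system and adj :: "nat \<Rightarrow> nat list" and \<delta> :: real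
  assumes wf: "wf_spin_system S" and adj: "adjacency_lists S adj" and norm: "normalized S"
    and soft: "soft_constraints \<delta> S" and \<delta>: "0 < \<delta>" "\<delta> < 1" and \<Delta>: "max_degree S \<ge> 1"
begin

abbreviation "q \<equiv> spins S"
abbreviation "lam \<equiv> ext_field S"
abbreviation "A \<equiv> interaction_probe S"

lemma q: "q \<ge> 2" and fin: "finite (verts S)" and edges_verts: "edges S \<subseteq> verts S \<times> verts S"
  and edge_irrefl: "(u, v) \<in> edges S \<Longrightarrow> u \<noteq> v" and edge_antisym: "(u, v) \<in> edges S \<Longrightarrow> (v, u) \<notin> edges S"
  and lam_nonneg: "v \<in> verts S \<Longrightarrow> c < q \<Longrightarrow> lam v c \<ge> 0"
  and lam_sum: "v \<in> verts S \<Longrightarrow> (\<Sum>c<q. lam v c) = 1"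
proof -
  show "q \<ge> 2" "finite (verts S)" "edges S \<subseteq> verts S \<times> verts S"
    "(u, v) \<in> edges S \<Longrightarrow> u \<noteq> v" "(u, v) \<in> edges S \<Longrightarrow> (v, u) \<notin> edges S"
    "v \<in> verts S \<Longrightarrow> c < q \<Longrightarrow> lam v c \<ge> 0"
    using wf by (simp_all add: wf_spin_system_def)
  show "v \<in> verts S \<Longrightarrow> (\<Sum>c<q. lam v c) = 1"
    using norm by (simp add: normalized_def)
qed

lemma finite_edges: "finite (edges S)"
  using finite_subset[OF edges_verts] fin by blast

lemma neighbours_verts: "neighbours S v \<subseteq> verts S - {v}"
  using edges_verts edge_irrefl by (auto simp: neighbours_def)

lemma set_adj: "v \<in> verts S \<Longrightarrow> set (adj v) = neighbours S v"
  and distinct_adj: "v \<in> verts S \<Longrightarrow> distinct (adj v)"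
  using adj by (auto simp: adjacency_lists_def)

lemma length_adj_le: "v \<in> verts S \<Longrightarrow> length (adj v) \<le> max_degree S"
proof -
  assume v: "v \<in> verts S"
  have "length (adj v) = degree S v"
    using distinct_card[OF distinct_adj[OF v]] set_adj[OF v] by (simp add: degree_def)
  also have "\<dots> \<le> max_degree S"
    unfolding max_degree_def by (rule cSUP_upper[OF v]) (use fin in auto)
  finally show ?thesis .
qed

lemma adj_nth: "v \<in> verts S \<Longrightarrow> i < length (adj v) \<Longrightarrow> adj v ! i \<in> verts S \<and> adj v ! i \<noteq> v"
  using set_adj[of v] neighbours_verts[of v] nth_mem[of i "adj v"] by auto

lemma interaction_bounds:
  assumes "e \<in> edges S" "c < q" "d < q"
  shows "interaction S e c d \<le> 1" "1 - (1 - \<delta>) / (2 * real (max_degree S)) \<le> interaction S e c d"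
proof -
  let ?M = "{interaction S e i j |i j. i < q \<and> j < q}"
  have "?M = (\<lambda>(i, j). interaction S e i j) ` ({..<q} \<times> {..<q})" by auto
  then have "finite ?M" by simp
  then have "interaction S e c d \<le> Max ?M" using assms by (intro Max_ge) auto
  then show "interaction S e c d \<le> 1" using norm assms by (auto simp: normalized_def)
  show "1 - (1 - \<delta>) / (2 * real (max_degree S)) \<le> interaction S e c d"
    using soft assms by (auto simp: soft_constraints_def)
qed

text \<open>
  The program cannot probe the maximum degree. The degree of the vertex at hand serves as well,
  since it gives a weaker lower bound on the interactions.
\<close>

definition reveal :: "nat \<Rightarrow> real" where
  "reveal v = (1 - \<delta>) / (2 * real (length (adj v)))"

lemma A_bounds:
  assumes "v \<in> verts S" "u \<in> neighbours S v" "c < q" "d < q"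
  shows "A v u c d \<le> 1" "1 - reveal v \<le> A v u c d"
proof -
  have "length (adj v) > 0" using assms set_adj[of v] by (cases "adj v") auto
  then have "reveal v \<ge> (1 - \<delta>) / (2 * real (max_degree S))"
    unfolding reveal_def using length_adj_le[OF assms(1)] \<delta> \<Delta>
    by (intro divide_left_mono mult_pos_pos) (auto simp del: length_greater_0_conv)
  then show "A v u c d \<le> 1" "1 - reveal v \<le> A v u c d"
    using interaction_bounds[of "(v,u)" c d] interaction_bounds[of "(u,v)" d c] assms
    by (auto simp: interaction_probe_def neighbours_def)
qed

lemma reveal_bounds:
  "0 \<le> reveal v" "reveal v \<le> 1 / 2" "adj v \<noteq> [] \<Longrightarrow> reveal v > 0"
  "real (length (adj v)) * reveal v \<le> (1 - \<delta>) / 2"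
proof -
  show "0 \<le> reveal v" "adj v \<noteq> [] \<Longrightarrow> reveal v > 0" using \<delta> by (auto simp: reveal_def)
  show "real (length (adj v)) * reveal v \<le> (1 - \<delta>) / 2" using \<delta> by (simp add: reveal_def)
  \<comment> \<open>For an isolated vertex the division by zero yields 0; otherwise the degree is at
    least 1.\<close>
  show "reveal v \<le> 1 / 2"
  proof (cases "adj v")
    case (Cons a l)
    then have "reveal v \<le> (1 - \<delta>) / (2 * 1)" unfolding reveal_def using \<delta> by (intro divide_left_mono) auto
    then show ?thesis using \<delta> by simp
  qed (simp add: reveal_def)
qed

section \<open>Partition functions with deleted and pinned vertices\<close>

definition rel_weight :: "nat set \<Rightarrow> nat set \<Rightarrow> (nat \<Rightarrow> nat) \<Rightarrow> real" where
  "rel_weight D U \<sigma> = (\<Prod>v\<in>U. lam v (\<sigma> v)) *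
     (\<Prod>(u, v)\<in>edges S \<inter> D \<times> D. interaction S (u, v) (\<sigma> u) (\<sigma> v))"

text \<open>The \<open>g\<close>-weighted partition function of the graph induced on
  \<open>D\<close>, with boundary condition \<open>\<tau>\<close> off \<open>U\<close>.
  Configurations are total functions, so that \<open>g\<close> reads pinned and free spins
  alike.\<close>

definition wsum :: "nat set \<Rightarrow> nat set \<Rightarrow> (nat \<Rightarrow> nat) \<Rightarrow> ((nat \<Rightarrow> nat) \<Rightarrow> real) \<Rightarrow> real" where
  "wsum D U \<tau> g = (\<Sum>\<rho>\<in>U \<rightarrow>\<^sub>E {..<q}. rel_weight D U (override_on \<tau> \<rho> U) * g (override_on \<tau> \<rho> U))"

text \<open>Fixing the spin of \<open>u\<close> releases only its field factor: \<open>D\<close> is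
  unchanged, so the edges at \<open>u\<close> stay in the weight and \<open>u\<close> merely joins
  the boundary.\<close>

lemma wsum_split:
  assumes "finite U" "u \<in> U"
  shows "wsum D U \<tau> g = (\<Sum>c<q. lam u c * wsum D (U - {u}) (\<tau>(u := c)) g)"
proof -
  define U' where "U' = U - {u}"
  have U: "U = insert u U'" "u \<notin> U'" "finite U'" using assms by (auto simp: U'_def)
  have ov: "override_on \<tau> (\<rho>(u := c)) U = override_on (\<tau>(u := c)) \<rho> U'" for \<rho> c
    using U by (auto simp: override_on_def)
  have w: "rel_weight D U (override_on (\<tau>(u := c)) \<rho> U') =
      lam u c * rel_weight D U' (override_on (\<tau>(u := c)) \<rho> U')" for \<rho> c
    using U by (simp add: rel_weight_def override_on_def)
  have "wsum D U \<tau> g = (\<Sum>(c, \<rho>)\<in>{..<q} \<times> (U' \<rightarrow>\<^sub>E {..<q}).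
      rel_weight D U (override_on \<tau> (\<rho>(u := c)) U) * g (override_on \<tau> (\<rho>(u := c)) U))"
    unfolding wsum_def by (subst (1) U(1), subst PiE_insert_eq, subst sum.reindex)
      (use inj_combinator[OF U(2), of "\<lambda>_. {..<q}"] in \<open>auto simp: case_prod_unfold\<close>)
  also have "\<dots> = (\<Sum>c<q. lam u c * wsum D U' (\<tau>(u := c)) g)"
    unfolding ov w by (simp add: sum.cartesian_product[symmetric] wsum_def sum_distrib_left mult.assoc)
  finally show ?thesis by (simp add: U'_def)
qed

lemma rel_weight_cong:
  "U \<subseteq> D \<Longrightarrow> (\<And>x. x \<in> D \<Longrightarrow> \<sigma> x = \<sigma>' x) \<Longrightarrow> rel_weight D U \<sigma> = rel_weight D U \<sigma>'"
  unfolding rel_weight_def by (intro arg_cong2[where f = "(*)"] prod.cong) auto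

lemma wsum_cong:
  assumes "U \<subseteq> D" "\<And>x. x \<in> D - U \<Longrightarrow> \<tau> x = \<tau>' x"
    and "\<And>\<sigma> \<sigma>'. (\<And>x. x \<in> D \<Longrightarrow> \<sigma> x = \<sigma>' x) \<Longrightarrow> (\<And>x. x \<in> U \<Longrightarrow> \<sigma> x < q)
      \<Longrightarrow> (\<And>x. x \<in> D - U \<Longrightarrow> \<sigma> x = \<tau> x) \<Longrightarrow> g \<sigma> = g' \<sigma>'"
  shows "wsum D U \<tau> g = wsum D U \<tau>' g'"
  unfolding wsum_def
proof (intro sum.cong refl arg_cong2[where f = "(*)"])
  fix \<rho> assume \<rho>: "\<rho> \<in> U \<rightarrow>\<^sub>E {..<q}"
  have eq: "override_on \<tau> \<rho> U x = override_on \<tau>' \<rho> U x" if "x \<in> D" for x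
    using assms(2) that by (auto simp: override_on_def)
  show "rel_weight D U (override_on \<tau> \<rho> U) = rel_weight D U (override_on \<tau>' \<rho> U)"
    using eq assms(1) by (intro rel_weight_cong) auto
  show "g (override_on \<tau> \<rho> U) = g' (override_on \<tau>' \<rho> U)"
    by (rule assms(3)) (use eq \<rho> in \<open>auto simp: override_on_def PiE_def Pi_def\<close>)
qed

lemma rel_weight_remove:
  assumes "u \<in> D" "D \<subseteq> verts S"
  shows "rel_weight D U \<sigma> =
    rel_weight (D - {u}) U \<sigma> * (\<Prod>w\<in>neighbours S u \<inter> (D - {u}). A u w (\<sigma> u) (\<sigma> w))"
proof -
  let ?D = "D - {u}" and ?N = "neighbours S u \<inter> (D - {u})"
  \<comment> \<open>Each edge is stored in one orientation only; \<open>?e\<close> recovers it from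
    the neighbour.\<close>
  let ?e = "\<lambda>w. if (u, w) \<in> edges S then (u, w) else (w, u)"
  have E: "edges S \<inter> D \<times> D = (edges S \<inter> ?D \<times> ?D) \<union> ?e ` ?N"
    using assms edge_irrefl[of u u] edge_antisym by (auto simp: neighbours_def image_iff split: if_splits)
  have inj: "inj_on ?e ?N" by (auto simp: inj_on_def split: if_splits)
  have "(\<Prod>(x, y)\<in>edges S \<inter> D \<times> D. interaction S (x, y) (\<sigma> x) (\<sigma> y)) =
     (\<Prod>(x, y)\<in>edges S \<inter> ?D \<times> ?D. interaction S (x, y) (\<sigma> x) (\<sigma> y)) *
     (\<Prod>(x, y)\<in>?e ` ?N. interaction S (x, y) (\<sigma> x) (\<sigma> y))"
    unfolding E using finite_edges finite_subset[OF assms(2) fin]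
    by (intro prod.union_disjoint) (auto split: if_splits)
  also have "(\<Prod>(x, y)\<in>?e ` ?N. interaction S (x, y) (\<sigma> x) (\<sigma> y)) =
      (\<Prod>w\<in>?N. A u w (\<sigma> u) (\<sigma> w))"
    unfolding prod.reindex[OF inj]
    by (intro prod.cong) (auto simp: interaction_probe_def neighbours_def)
  finally show ?thesis by (simp add: rel_weight_def)
qed

text \<open>The soft bound is positive because \<Delta> \<ge> 1 and \<delta> > 0, and every
  normalized field has a colour of positive weight. Fields of pinned vertices are absent from
  \<open>rel_weight\<close>, so pins of field zero do no harm.\<close>

lemma wsum_pos:
  assumes "finite U" "U \<subseteq> D" "D \<subseteq> verts S" "\<And>x. x \<in> D - U \<Longrightarrow> \<tau> x < q"
  shows "wsum D U \<tau> (\<lambda>_. 1) > 0"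
  using assms
proof (induction U arbitrary: \<tau> rule: finite_induct)
  case empty
  have "interaction S e (\<tau> (fst e)) (\<tau> (snd e)) > 0" if "e \<in> edges S \<inter> D \<times> D" for e
  proof -
    have "(1 - \<delta>) / (2 * real (max_degree S)) < 1"
      using \<Delta> \<delta> by (subst divide_less_eq_1_pos) auto
    then show ?thesis
      using interaction_bounds(2)[of e "\<tau> (fst e)" "\<tau> (snd e)"] that empty.prems(3) by force
  qed
  then show ?case by (auto simp: wsum_def rel_weight_def override_on_def case_prod_unfold intro!: prod_pos)
next
  case (insert u U)
  have pos: "wsum D U (\<tau>(u := c)) (\<lambda>_. 1) > 0" if "c < q" for c
    using insert.prems that by (intro insert.IH) auto
  have u: "u \<in> verts S" using insert.prems by auto
  have "wsum D (insert u U) \<tau> (\<lambda>_. 1) = (\<Sum>c<q. lam u c * wsum D U (\<tau>(u := c)) (\<lambda>_. 1))"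
    using wsum_split[of "insert u U" u D \<tau>] insert.hyps by simp
  moreover obtain c where c: "c < q" "lam u c > 0"
  proof -
    have "(\<Sum>c<q. lam u c) > 0" using lam_sum[OF u] by simp
    then show ?thesis using that
      by (metis (mono_tags, lifting) lessThan_iff not_le sum_nonpos)
  qed
  moreover have "(\<Sum>c<q. lam u c * wsum D U (\<tau>(u := c)) (\<lambda>_. 1)) > 0"
    using lam_nonneg[OF u] pos c
    by (intro sum_pos2[of _ c]) (auto intro!: mult_nonneg_nonneg intro: less_imp_le)
  ultimately show ?case by simp
qed

lemma rel_weight_nonneg:
  assumes "U \<subseteq> D" "D \<subseteq> verts S" "\<And>x. x \<in> D \<Longrightarrow> \<sigma> x < q"
  shows "rel_weight D U \<sigma> \<ge> 0"
proof -
  have "interaction S e (\<sigma> (fst e)) (\<sigma> (snd e)) \<ge> 0" if "e \<in> edges S \<inter> D \<times> D" for e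
    using that assms(3)[of "fst e"] assms(3)[of "snd e"] wf unfolding wf_spin_system_def by force
  then show ?thesis unfolding rel_weight_def
    using assms lam_nonneg by (intro mult_nonneg_nonneg prod_nonneg) (auto simp: subset_iff)
qed

text \<open>
  Below, \<open>G\<close> is a set of vertices that have been deleted from the graph and the list \<open>P\<close> of
  vertex-colour pairs is a boundary condition.
\<close>

definition pin_val :: "(nat \<times> nat) list \<Rightarrow> nat \<Rightarrow> nat" where
  "pin_val P u = (case map_of P u of Some c \<Rightarrow> c | None \<Rightarrow> 0)"

definition pinned :: "(nat \<times> nat) list \<Rightarrow> nat set" where
  "pinned P = fst ` set P"

definition ok_pins :: "(nat \<times> nat) list \<Rightarrow> bool" where
  "ok_pins P \<longleftrightarrow> (\<forall>(u, c)\<in>set P. u \<in> verts S \<and> c < q)"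

definition cond_exp :: "nat set \<Rightarrow> (nat \<times> nat) list \<Rightarrow> ((nat \<Rightarrow> nat) \<Rightarrow> real) \<Rightarrow> real" where
  "cond_exp G P g = wsum (verts S - G) (verts S - G - pinned P) (pin_val P) g /
     wsum (verts S - G) (verts S - G - pinned P) (pin_val P) (\<lambda>_. 1)"

definition marg :: "nat set \<Rightarrow> (nat \<times> nat) list \<Rightarrow> nat \<Rightarrow> nat \<Rightarrow> real" where
  "marg G P v c = cond_exp G P (\<lambda>\<sigma>. of_bool (\<sigma> v = c))"

text \<open>With \<open>w\<close> in \<open>G\<close>, this is the probability that a proposal
  \<open>c\<close> at \<open>w\<close> survives the neighbours from position \<open>i\<close> on.
  Deleted neighbours contribute no factor.\<close>

definition accept :: "nat set \<Rightarrow> (nat \<times> nat) list \<Rightarrow> nat \<Rightarrow> nat \<Rightarrow> nat \<Rightarrow> real" where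
  "accept G P w c i = cond_exp G P (\<lambda>\<sigma>. \<Prod>u\<in>set (drop i (adj w)) \<inter> (verts S - G). A w u c (\<sigma> u))"

lemma pinned_append [simp]: "pinned (P @ Q) = pinned P \<union> pinned Q"
  and pinned_Cons [simp]: "pinned (x # P) = insert (fst x) (pinned P)"
  and pinned_Nil [simp]: "pinned [] = {}"
  by (auto simp: pinned_def)

lemma ok_pins_append [simp]: "ok_pins (P @ Q) \<longleftrightarrow> ok_pins P \<and> ok_pins Q"
  and ok_pins_Cons [simp]: "ok_pins (x # P) \<longleftrightarrow> fst x \<in> verts S \<and> snd x < q \<and> ok_pins P"
  and ok_pins_Nil [simp]: "ok_pins []"
  by (auto simp: ok_pins_def)

lemma pin_val_snoc: "u \<notin> pinned P \<Longrightarrow> pin_val (P @ [(u, c)]) = (pin_val P)(u := c)"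
  by (auto simp: pin_val_def fun_eq_iff map_add_def pinned_def split: option.splits)
    (auto dest!: map_of_SomeD simp: image_iff)

text \<open>Unpinned vertices read the default 0, which is itself a colour, so the bound holds at
  every vertex.\<close>

lemma pin_val_less: "ok_pins P \<Longrightarrow> pin_val P u < q"
  using q by (auto simp: pin_val_def ok_pins_def split: option.splits dest!: map_of_SomeD)

lemma pin_val_mem: "distinct (map fst P) \<Longrightarrow> (u, c) \<in> set P \<Longrightarrow> pin_val P u = c"
  by (simp add: pin_val_def)

lemma cond_exp_denominator_pos:
  "ok_pins P \<Longrightarrow> wsum (verts S - G) (verts S - G - pinned P) (pin_val P) (\<lambda>_. 1) > 0"
  using fin by (intro wsum_pos) (auto simp: pin_val_less)

lemma cond_exp_cong:
  assumes "\<And>\<sigma>. (\<And>x. x \<in> verts S - G \<Longrightarrow> \<sigma> x < q) \<Longrightarrow>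
      (\<And>x. x \<in> (verts S - G) \<inter> pinned P \<Longrightarrow> \<sigma> x = pin_val P x) \<Longrightarrow> g \<sigma> = h \<sigma>" and "ok_pins P"
  shows "cond_exp G P g = cond_exp G P h"
proof -
  have "wsum (verts S - G) (verts S - G - pinned P) (pin_val P) g =
      wsum (verts S - G) (verts S - G - pinned P) (pin_val P) h"
    unfolding wsum_def
  proof (intro sum.cong refl arg_cong2[where f = "(*)"])
    fix \<rho> assume \<rho>: "\<rho> \<in> (verts S - G - pinned P) \<rightarrow>\<^sub>E {..<q}"
    show "g (override_on (pin_val P) \<rho> (verts S - G - pinned P)) =
        h (override_on (pin_val P) \<rho> (verts S - G - pinned P))"
      by (rule assms(1)) (use \<rho> pin_val_less[OF assms(2)] in \<open>auto simp: override_on_def PiE_def Pi_def\<close>)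
  qed
  then show ?thesis by (simp add: cond_exp_def)
qed

lemma cond_exp_mono:
  assumes "\<And>\<sigma>. (\<And>x. x \<in> verts S - G \<Longrightarrow> \<sigma> x < q) \<Longrightarrow> g \<sigma> \<le> h \<sigma>" and "ok_pins P"
  shows "cond_exp G P g \<le> cond_exp G P h"
  unfolding cond_exp_def wsum_def
proof (intro divide_right_mono sum_mono mult_left_mono)
  fix \<rho> assume \<rho>: "\<rho> \<in> (verts S - G - pinned P) \<rightarrow>\<^sub>E {..<q}"
  have *: "override_on (pin_val P) \<rho> (verts S - G - pinned P) x < q" for x
    using \<rho> pin_val_less[OF assms(2)] by (auto simp: override_on_def PiE_def Pi_def)
  show "g (override_on (pin_val P) \<rho> (verts S - G - pinned P))
      \<le> h (override_on (pin_val P) \<rho> (verts S - G - pinned P))"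
    by (rule assms(1)) (rule *)
  show "0 \<le> rel_weight (verts S - G) (verts S - G - pinned P)
      (override_on (pin_val P) \<rho> (verts S - G - pinned P))"
    by (rule rel_weight_nonneg) (auto intro: *)
next
  show "0 \<le> (\<Sum>\<rho>\<in>(verts S - G - pinned P) \<rightarrow>\<^sub>E {..<q}. rel_weight (verts S - G)
      (verts S - G - pinned P) (override_on (pin_val P) \<rho> (verts S - G - pinned P)) * 1)"
    using cond_exp_denominator_pos[OF assms(2)] by (auto simp: wsum_def intro: less_imp_le)
qed

lemma cond_exp_cmult: "cond_exp G P (\<lambda>\<sigma>. a * g \<sigma>) = a * cond_exp G P g"
  by (simp add: cond_exp_def wsum_def sum_distrib_left mult_ac)

lemma cond_exp_const: "ok_pins P \<Longrightarrow> cond_exp G P (\<lambda>_. a) = a"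
  using cond_exp_cmult[of G P a "\<lambda>_. 1"] cond_exp_denominator_pos[of P G] by (simp add: cond_exp_def)

lemma marg_eq:
  assumes "v \<in> verts S - G - pinned P" "c < q"
  shows "marg G P v c = lam v c *
      wsum (verts S - G) (verts S - G - pinned P - {v}) ((pin_val P)(v := c)) (\<lambda>_. 1) /
      wsum (verts S - G) (verts S - G - pinned P) (pin_val P) (\<lambda>_. 1)"
proof -
  let ?D = "verts S - G" and ?U = "verts S - G - pinned P"
  have *: "wsum ?D (?U - {v}) ((pin_val P)(v := c')) (\<lambda>\<sigma>. of_bool (\<sigma> v = c)) =
      of_bool (c' = c) * wsum ?D (?U - {v}) ((pin_val P)(v := c')) (\<lambda>_. 1)" for c'
    by (simp add: wsum_def override_on_def)
  have "wsum ?D ?U (pin_val P) (\<lambda>\<sigma>. of_bool (\<sigma> v = c)) =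
      (\<Sum>c'<q. lam v c' * (of_bool (c' = c) * wsum ?D (?U - {v}) ((pin_val P)(v := c')) (\<lambda>_. 1)))"
    using wsum_split[of ?U v ?D "pin_val P"] fin assms(1) * by simp
  also have "\<dots> = (\<Sum>c'<q. if c' = c then lam v c * wsum ?D (?U - {v}) ((pin_val P)(v := c)) (\<lambda>_. 1) else 0)"
    by (intro sum.cong) auto
  also have "\<dots> = lam v c * wsum ?D (?U - {v}) ((pin_val P)(v := c)) (\<lambda>_. 1)"
    using assms by simp
  finally show ?thesis by (simp add: marg_def cond_exp_def)
qed

text \<open>The partition function with \<open>v\<close> pinned to \<open>c\<close> is a factor of
  the numerator of \<open>marg\<close> and the denominator of the conditioned expectation. It is
  positive and cancels, even for colours of field zero.\<close>

lemma total_expectation: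
  assumes "v \<in> verts S - G - pinned P" "ok_pins P"
  shows "cond_exp G P g = (\<Sum>c<q. marg G P v c * cond_exp G (P @ [(v, c)]) g)"
proof -
  let ?D = "verts S - G" and ?U = "verts S - G - pinned P"
  have U: "?U - {v} = ?D - pinned (P @ [(v, c)])" for c by auto
  have "marg G P v c * cond_exp G (P @ [(v, c)]) g =
      lam v c * wsum ?D (?U - {v}) ((pin_val P)(v := c)) g / wsum ?D ?U (pin_val P) (\<lambda>_. 1)"
    if "c < q" for c
  proof -
    have "wsum ?D (?U - {v}) ((pin_val P)(v := c)) (\<lambda>_. 1) > 0"
      using cond_exp_denominator_pos[of "P @ [(v, c)]" G] assms that
      by (simp add: pin_val_snoc U[symmetric] del: pinned_append)
    then show ?thesis
      using marg_eq[OF assms(1) that] assms(1)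
      by (simp add: cond_exp_def pin_val_snoc U[symmetric] del: pinned_append)
  qed
  moreover have "wsum ?D ?U (pin_val P) g = (\<Sum>c<q. lam v c * wsum ?D (?U - {v}) ((pin_val P)(v := c)) g)"
    using fin assms(1) by (intro wsum_split) auto
  ultimately show ?thesis by (simp add: cond_exp_def sum_divide_distrib)
qed

lemma marg_nonneg: "ok_pins P \<Longrightarrow> marg G P v c \<ge> 0"
  using cond_exp_mono[of G "\<lambda>_. 0" "\<lambda>\<sigma>. of_bool (\<sigma> v = c)" P] cond_exp_const[of P G 0]
  by (simp add: marg_def)

lemma marg_sum:
  assumes "v \<in> verts S - G - pinned P" "ok_pins P"
  shows "(\<Sum>c<q. marg G P v c) = 1"
proof -
  have "1 = (\<Sum>c<q. marg G P v c * cond_exp G (P @ [(v, c)]) (\<lambda>_. 1))"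
    using total_expectation[OF assms, of "\<lambda>_. 1"] cond_exp_const assms by simp
  also have "\<dots> = (\<Sum>c<q. marg G P v c)"
    using assms by (intro sum.cong) (auto simp: cond_exp_const)
  finally show ?thesis by simp
qed

section \<open>Acceptance probabilities of a proposal\<close>

lemma neighbours_drop: "w \<in> verts S \<Longrightarrow> set (drop i (adj w)) \<subseteq> neighbours S w"
  using set_drop_subset[of i "adj w"] by (simp add: set_adj)

lemma accept_le_1:
  assumes "w \<in> verts S" "c < q" "ok_pins P"
  shows "accept G P w c i \<le> 1"
proof -
  have "accept G P w c i \<le> cond_exp G P (\<lambda>_. 1)"
    unfolding accept_def
  proof (rule cond_exp_mono[OF _ assms(3)], intro prod_le_1)
    fix \<sigma> u assume *: "\<And>x. x \<in> verts S - G \<Longrightarrow> \<sigma> x < q"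
      and u: "u \<in> set (drop i (adj w)) \<inter> (verts S - G)"
    have "u \<in> neighbours S w" "\<sigma> u < q" using u * neighbours_drop[OF assms(1)] by auto
    then show "0 \<le> A w u c (\<sigma> u) \<and> A w u c (\<sigma> u) \<le> 1"
      using A_bounds[OF assms(1) _ assms(2)] reveal_bounds(2)[of w] by force
  qed
  then show ?thesis using assms by (simp add: cond_exp_const)
qed

text \<open>By Bernoulli's inequality, at most d factors that are at least 1 - p have product at
  least 1 - d p. Here d is the degree, p is \<open>reveal w\<close>, and d p \<le> (1 - \<delta>) /
  2.\<close>

lemma accept_ge:
  assumes "w \<in> verts S" "c < q" "ok_pins P"
  shows "accept G P w c i \<ge> (1 + \<delta>) / 2"
proof -
  have "cond_exp G P (\<lambda>_. (1 + \<delta>) / 2) \<le> accept G P w c i"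
    unfolding accept_def
  proof (rule cond_exp_mono[OF _ assms(3)])
    fix \<sigma> assume *: "\<And>x. x \<in> verts S - G \<Longrightarrow> \<sigma> x < q"
    let ?N = "set (drop i (adj w)) \<inter> (verts S - G)"
    have "card ?N \<le> card (set (drop i (adj w)))" by (intro card_mono) auto
    also have "\<dots> \<le> length (adj w)" using card_length[of "drop i (adj w)"] by simp
    finally have card: "card ?N \<le> length (adj w)" .
    have "(1 + \<delta>) / 2 \<le> 1 - real (length (adj w)) * reveal w"
      using reveal_bounds(4)[of w] by (simp add: field_simps)
    also have "\<dots> \<le> 1 + real (card ?N) * (- reveal w)"
      using card reveal_bounds(1)[of w] by (simp add: mult_right_mono)
    also have "\<dots> \<le> (1 + (- reveal w)) ^ card ?N"
      using reveal_bounds[of w] by (intro Bernoulli_inequality) simp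
    also have "\<dots> = (\<Prod>u\<in>?N. 1 - reveal w)" by simp
    also have "\<dots> \<le> (\<Prod>u\<in>?N. A w u c (\<sigma> u))"
    proof (intro prod_mono)
      fix u assume u: "u \<in> ?N"
      have "u \<in> neighbours S w" "\<sigma> u < q" using u * neighbours_drop[OF assms(1)] by auto
      then show "0 \<le> 1 - reveal w \<and> 1 - reveal w \<le> A w u c (\<sigma> u)"
        using A_bounds[OF assms(1) _ assms(2)] reveal_bounds(2)[of w] by force
    qed
    finally show "(1 + \<delta>) / 2 \<le> (\<Prod>u\<in>?N. A w u c (\<sigma> u))" .
  qed
  then show ?thesis using assms by (simp add: cond_exp_const)
qed

lemma accept_end: "length (adj w) \<le> i \<Longrightarrow> ok_pins P \<Longrightarrow> accept G P w c i = 1"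
  by (simp add: accept_def cond_exp_const)

lemma accept_ghost:
  "i < length (adj w) \<Longrightarrow> adj w ! i \<in> G \<Longrightarrow> accept G P w c i = accept G P w c (Suc i)"
  by (simp add: accept_def Cons_nth_drop_Suc[symmetric])

lemma accept_prod_Suc:
  assumes "w \<in> verts S" "i < length (adj w)" "adj w ! i \<notin> G"
  shows "(\<Prod>u\<in>set (drop i (adj w)) \<inter> (verts S - G). A w u c (\<sigma> u)) =
    A w (adj w ! i) c (\<sigma> (adj w ! i)) * (\<Prod>u\<in>set (drop (Suc i) (adj w)) \<inter> (verts S - G). A w u c (\<sigma> u))"
proof -
  have "set (drop i (adj w)) \<inter> (verts S - G) =
      insert (adj w ! i) (set (drop (Suc i) (adj w)) \<inter> (verts S - G))"
    using assms adj_nth by (auto simp: Cons_nth_drop_Suc[symmetric])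
  moreover have "adj w ! i \<notin> set (drop (Suc i) (adj w))"
    using distinct_drop[OF distinct_adj[OF assms(1)], of i] assms(2)
    by (auto simp: Cons_nth_drop_Suc[symmetric])
  ultimately show ?thesis by simp
qed

lemma accept_pinned:
  assumes "w \<in> verts S" "i < length (adj w)" "adj w ! i \<notin> G" "adj w ! i \<in> pinned P" "ok_pins P"
  shows "accept G P w c i = A w (adj w ! i) c (pin_val P (adj w ! i)) * accept G P w c (Suc i)"
  unfolding accept_def accept_prod_Suc[OF assms(1-3)] cond_exp_cmult[symmetric]
  using assms adj_nth by (intro cond_exp_cong) auto

text \<open>Total expectation over the spin of the next neighbour; once that spin is pinned, its
  factor is constant.\<close>

lemma accept_free:
  assumes "w \<in> verts S" "i < length (adj w)" "adj w ! i \<in> verts S - G - pinned P" "ok_pins P"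
  shows "accept G P w c i = (\<Sum>d<q. marg G P (adj w ! i) d *
      (A w (adj w ! i) c d * accept G (P @ [(adj w ! i, d)]) w c (Suc i)))"
proof -
  have "accept G (P @ [(adj w ! i, d)]) w c i =
      A w (adj w ! i) c d * accept G (P @ [(adj w ! i, d)]) w c (Suc i)" if "d < q" for d
    using accept_pinned[of w i G "P @ [(adj w ! i, d)]" c] assms that by (simp add: pin_val_snoc)
  moreover have "accept G P w c i = (\<Sum>d<q. marg G P (adj w ! i) d * accept G (P @ [(adj w ! i, d)]) w c i)"
    unfolding accept_def by (rule total_expectation[OF assms(3,4)])
  ultimately show ?thesis by simp
qed

text \<open>With \<open>w\<close> coloured \<open>c\<close>, the weight splits into the edges at
  \<open>w\<close> and the weight of the graph without \<open>w\<close>. The partition function of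
  the latter is common to all colours and cancels, leaving Bayes' formula for rejection
  sampling.\<close>

lemma marg_accept:
  assumes "w \<in> verts S - G - pinned P" "ok_pins P" "c < q"
  shows "marg G P w c = lam w c * accept (insert w G) P w c 0 /
    (\<Sum>c<q. lam w c * accept (insert w G) P w c 0)"
proof -
  let ?D = "verts S - G" and ?U = "verts S - G - pinned P"
  let ?Z = "wsum (verts S - insert w G) (verts S - insert w G - pinned P) (pin_val P) (\<lambda>_. 1)"
  have Z: "?Z > 0" using cond_exp_denominator_pos[OF assms(2)] .
  have eq: "wsum ?D (?U - {w}) ((pin_val P)(w := c)) (\<lambda>_. 1) = accept (insert w G) P w c 0 * ?Z" for c
  proof -
    have D: "?D - {w} = verts S - insert w G" "?U - {w} = verts S - insert w G - pinned P" by auto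
    have "wsum ?D (?U - {w}) ((pin_val P)(w := c)) (\<lambda>_. 1) =
        wsum (?D - {w}) (?U - {w}) ((pin_val P)(w := c))
          (\<lambda>\<sigma>. \<Prod>u\<in>neighbours S w \<inter> (?D - {w}). A w u c (\<sigma> u))"
      unfolding wsum_def using assms(1)
      by (intro sum.cong refl) (subst rel_weight_remove[of w], auto simp: override_on_def)
    \<comment> \<open>The vertex \<open>w\<close> is now outside the graph, so its colour survives
      only as the argument \<open>c\<close> in the product.\<close>
    also have "\<dots> = wsum (?D - {w}) (?U - {w}) (pin_val P)
          (\<lambda>\<sigma>. \<Prod>u\<in>neighbours S w \<inter> (?D - {w}). A w u c (\<sigma> u))"
      by (intro wsum_cong) (auto intro!: prod.cong)
    finally show ?thesis using Z assms(1) by (simp add: accept_def cond_exp_def set_adj D)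
  qed
  have "wsum ?D ?U (pin_val P) (\<lambda>_. 1) = (\<Sum>c<q. lam w c * accept (insert w G) P w c 0) * ?Z"
    using wsum_split[of ?U w ?D "pin_val P" "\<lambda>_. 1"] fin assms(1)
    by (simp add: eq sum_distrib_right mult.assoc)
  then show ?thesis using Z assms by (simp add: marg_eq eq)
qed

section \<open>Fully pinned sets, the Gibbs marginal, and draws from a field\<close>

lemma cond_exp_all_pinned:
  assumes "\<Lambda> \<subseteq> pinned P" "\<Lambda> \<subseteq> verts S" "ok_pins P"
  shows "cond_exp {} P (\<lambda>\<sigma>. f (restrict \<sigma> \<Lambda>)) = f (restrict (pin_val P) \<Lambda>)"
proof -
  have "cond_exp {} P (\<lambda>\<sigma>. f (restrict \<sigma> \<Lambda>)) = cond_exp {} P (\<lambda>_. f (restrict (pin_val P) \<Lambda>))"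
    using assms by (intro cond_exp_cong arg_cong[where f = f]) (auto simp: restrict_def fun_eq_iff subset_iff)
  then show ?thesis using assms by (simp add: cond_exp_const)
qed

lemma cond_exp_gibbs:
  assumes "\<Lambda> \<subseteq> verts S"
  shows "cond_exp {} [] (\<lambda>\<sigma>. of_bool (restrict \<sigma> \<Lambda> = \<tau>)) = gibbs_marginal S \<Lambda> \<tau>"
proof -
  have w: "rel_weight (verts S) (verts S) (override_on \<tau> \<rho> (verts S)) = weight S \<rho>" for \<rho> \<tau>
  proof -
    have "rel_weight (verts S) (verts S) (override_on \<tau> \<rho> (verts S)) = rel_weight (verts S) (verts S) \<rho>"
      by (intro rel_weight_cong) (auto simp: override_on_def)
    then show ?thesis using edges_verts by (simp add: rel_weight_def weight_def Int_absorb2)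
  qed
  have r: "restrict (override_on \<tau>' \<rho> (verts S)) \<Lambda> = restrict \<rho> \<Lambda>" for \<rho> \<tau>' :: "nat \<Rightarrow> nat"
    using assms by (auto simp: restrict_def override_on_def fun_eq_iff)
  have f: "finite (configs S (verts S))" unfolding configs_def using fin by (intro finite_PiE) auto
  have "gibbs_marginal S \<Lambda> \<tau> = (\<Sum>\<sigma>\<in>configs S (verts S). gibbs S \<sigma> * of_bool (restrict \<sigma> \<Lambda> = \<tau>))"
    unfolding gibbs_marginal_def by (intro sum.mono_neutral_cong_left) (use f in auto)
  then show ?thesis
    by (simp add: cond_exp_def wsum_def w r gibbs_def partition_function_def configs_def
        sum_divide_distrib)
qed

lemma gibbs_marginal_bounds:
  assumes "\<Lambda> \<subseteq> verts S"
  shows "0 \<le> gibbs_marginal S \<Lambda> \<tau>" "gibbs_marginal S \<Lambda> \<tau> \<le> 1"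
  unfolding cond_exp_gibbs[OF assms, symmetric]
  using cond_exp_mono[of "{}" "\<lambda>_. 0" "\<lambda>\<sigma>. of_bool (restrict \<sigma> \<Lambda> = \<tau>)" "[]"]
    cond_exp_mono[of "{}" "\<lambda>\<sigma>. of_bool (restrict \<sigma> \<Lambda> = \<tau>)" "\<lambda>_. 1" "[]"]
  by (simp_all add: cond_exp_const)

lemma cond_exp_gibbs_compl:
  assumes "\<Lambda> \<subseteq> verts S"
  shows "cond_exp {} [] (\<lambda>\<sigma>. of_bool (restrict \<sigma> \<Lambda> \<noteq> \<tau>)) = 1 - gibbs_marginal S \<Lambda> \<tau>"
proof -
  have "cond_exp {} [] (\<lambda>\<sigma>. of_bool (restrict \<sigma> \<Lambda> \<noteq> \<tau>)) +
      cond_exp {} [] (\<lambda>\<sigma>. of_bool (restrict \<sigma> \<Lambda> = \<tau>)) = cond_exp {} [] (\<lambda>\<sigma>. 1)"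
    unfolding cond_exp_def add_divide_distrib[symmetric] wsum_def sum.distrib[symmetric]
      distrib_left[symmetric]
    by (intro arg_cong2[where f = "(/)"] sum.cong refl arg_cong2[where f = "(*)"]) auto
  then show ?thesis using assms by (simp add: cond_exp_gibbs cond_exp_const)
qed

text \<open>\<open>embed_pmf\<close> is characterised only for mass functions of total 1, which
  normalization provides.\<close>

lemma nn_integral_field_pmf:
  assumes "v \<in> verts S"
  shows "(\<integral>\<^sup>+ c. F c \<partial>field_pmf S v) = (\<Sum>c<q. F c * ennreal (lam v c))"
proof -
  let ?f = "\<lambda>c. if c < q then lam v c else 0"
  have nn: "\<And>c. 0 \<le> ?f c" using lam_nonneg[OF assms] by simp
  have "(\<integral>\<^sup>+ c. ennreal (?f c) \<partial>count_space UNIV) = (\<Sum>c<q. ennreal (?f c))"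
    by (rule nn_integral_count_space'[of "{..<q}"]) auto
  also have "\<dots> = ennreal (\<Sum>c<q. lam v c)" using lam_nonneg[OF assms] by (subst sum_ennreal) auto
  also have "\<dots> = 1" using lam_sum[OF assms] by simp
  finally have one: "(\<integral>\<^sup>+ c. ennreal (?f c) \<partial>count_space UNIV) = 1" .
  have pmf: "pmf (field_pmf S v) c = ?f c" for c
    using pmf_embed_pmf[OF nn one] assms by (simp add: field_pmf_def)
  have "(\<integral>\<^sup>+ c. F c \<partial>field_pmf S v) = (\<Sum>c<q. F c * ennreal (pmf (field_pmf S v) c))"
    by (rule nn_integral_measure_pmf_support) (auto simp: set_pmf_eq pmf)
  then show ?thesis by (simp add: pmf)
qed

lemma bounded_by_field_pmf:
  assumes "v \<in> verts S" "\<And>c. c < q \<Longrightarrow> bounded_by (F c) (y c)" "(\<Sum>c<q. lam v c * y c) \<le> z"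
  shows "bounded_by (\<integral>\<^sup>+ c. F c \<partial>field_pmf S v) z"
proof -
  have "(\<integral>\<^sup>+ c. F c \<partial>field_pmf S v) \<le> (\<Sum>c<q. ennreal (y c) * ennreal (lam v c))"
    unfolding nn_integral_field_pmf[OF assms(1)]
    using assms(2) by (intro sum_mono mult_right_mono) (auto simp: bounded_by_def)
  also have "\<dots> = (\<Sum>c<q. ennreal (lam v c * y c))"
    using assms(2) lam_nonneg[OF assms(1)]
    by (intro sum.cong) (auto simp: ennreal_mult mult.commute bounded_by_def)
  also have "\<dots> = ennreal (\<Sum>c<q. lam v c * y c)"
    using assms(2) lam_nonneg[OF assms(1)] by (intro sum_ennreal) (auto simp: bounded_by_def)
  also have "\<dots> \<le> ennreal z" using assms(3) by (rule ennreal_leI)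
  finally have "(\<integral>\<^sup>+ c. F c \<partial>field_pmf S v) \<le> ennreal z" .
  moreover have "0 \<le> (\<Sum>c<q. lam v c * y c)"
    using assms(2) lam_nonneg[OF assms(1)] by (intro sum_nonneg) (auto simp: bounded_by_def)
  ultimately show ?thesis using assms(3) unfolding bounded_by_def by linarith
qed

end

section \<open>The program\<close>

text \<open>
  The recursion uses an explicit stack of height \<open>d\<close> in the arrays \<open>sv\<close> (vertex), \<open>sc\<close> (proposed
  colour), \<open>si\<close> (neighbour index) and \<open>sh\<close> (number of pins at the time of the call); the array \<open>ghost\<close>
  marks the vertices on the stack, which count as deleted. The pinned vertices are the first \<open>t\<close>
  entries of \<open>trail\<close>, and \<open>u\<close> is pinned iff \<open>pos u < t\<close> and \<open>trail (pos u) = u\<close>, so that resetting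
  \<open>t\<close> unpins in constant time. The flag \<open>f\<close> tells whether the top frame is to start an attempt (0), to
  look at its current neighbour (1), or to test that neighbour's known spin (2).
\<close>

definition top_entry :: "vname \<Rightarrow> aexp" where
  "top_entry a = Arr a (V ''d'') (N 0)"

definition next_nb :: aexp where
  "next_nb = Neighbour (top_entry ''sv'') (top_entry ''si'')"

definition reveal_exp :: "real \<Rightarrow> rexp" where
  "reveal_exp \<delta> = RDivide (R (1 - \<delta>)) (RTimes (R 2) (OfNat (Degree (top_entry ''sv''))))"

text \<open>With p the bias of the coin that reveals the neighbour's spin, this bias b solves (1 -
  p) + p b = A. The two coins together therefore pass with exactly the probability given by the
  interaction entry A.\<close>

definition pass_exp :: "real \<Rightarrow> rexp" where
  "pass_exp \<delta> = RMinus (R 1) (RDivide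
     (RMinus (R 1) (Interaction (top_entry ''sv'') next_nb (top_entry ''sc'') (Arr ''output'' next_nb (N 0))))
     (reveal_exp \<delta>))"

definition pinned_test :: "aexp \<Rightarrow> bexp" where
  "pinned_test a = And (Less (Arr ''pos'' a (N 0)) (V ''t'')) (Eq (Arr ''trail'' (Arr ''pos'' a (N 0)) (N 0)) a)"

definition advance :: com where
  "advance = Store ''si'' (V ''d'') (N 0) (Plus (top_entry ''si'') (N 1))"

text \<open>The expression \<open>a\<close> may refer to the top frame, so the stack height is
  raised only after its last evaluation.\<close>

definition call :: "aexp \<Rightarrow> com" where
  "call a =
     Seq (Store ''sv'' (Plus (V ''d'') (N 1)) (N 0) a)
    (Seq (Store ''sh'' (Plus (V ''d'') (N 1)) (N 0) (V ''t''))
    (Seq (Store ''ghost'' a (N 0) (N 1))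
    (Seq (Assign ''d'' (Plus (V ''d'') (N 1)))
         (Assign ''f'' (N 0)))))"

definition propose :: com where
  "propose =
     Seq (Assign ''t'' (top_entry ''sh''))
    (Seq (Draw ''x'' (top_entry ''sv''))
    (Seq (Store ''sc'' (V ''d'') (N 0) (V ''x''))
    (Seq (Store ''si'' (V ''d'') (N 0) (N 0))
         (Assign ''f'' (N 1)))))"

text \<open>Pins made during the call are dropped and one pin for the sampled vertex is added, so
  the caller finds its own trail extended by exactly the spin it asked for.\<close>

definition return :: com where
  "return =
     Seq (Assign ''t'' (top_entry ''sh''))
    (Seq (Store ''trail'' (V ''t'') (N 0) (top_entry ''sv''))
    (Seq (Store ''pos'' (top_entry ''sv'') (N 0) (V ''t''))
    (Seq (Store ''output'' (top_entry ''sv'') (N 0) (top_entry ''sc''))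
    (Seq (Store ''ghost'' (top_entry ''sv'') (N 0) (N 0))
    (Seq (Assign ''t'' (Plus (V ''t'') (N 1)))
    (Seq (Assign ''d'' (Minus (V ''d'') (N 1)))
         (If (Eq (V ''d'') (N 0)) (Assign ''k'' (Plus (V ''k'') (N 1))) (Assign ''f'' (N 2)))))))))"

definition scan :: "real \<Rightarrow> com" where
  "scan \<delta> =
     If (Less (top_entry ''si'') (Degree (top_entry ''sv'')))
       (If (Eq (Arr ''ghost'' next_nb (N 0)) (N 1)) advance
         (Seq (Flip ''x'' (reveal_exp \<delta>))
           (If (Eq (V ''x'') (N 0)) advance
             (If (pinned_test next_nb) (Assign ''f'' (N 2)) (call next_nb)))))
       return"

definition check :: "real \<Rightarrow> com" where
  "check \<delta> =
     Seq (Flip ''x'' (pass_exp \<delta>))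
       (If (Eq (V ''x'') (N 1)) (Seq advance (Assign ''f'' (N 1))) (Assign ''f'' (N 0)))"

definition body :: "real \<Rightarrow> com" where
  "body \<delta> =
     If (Eq (V ''d'') (N 0)) (call (Arr ''input'' (V ''k'') (N 0)))
       (If (Eq (V ''f'') (N 0)) propose (If (Eq (V ''f'') (N 1)) (scan \<delta>) (check \<delta>)))"

definition sampler :: "real \<Rightarrow> com" where
  "sampler \<delta> = While (Less (V ''k'') (V ''m'')) (body \<delta>)"

lemma set_state_simps [simp]:
  "scalars (set_scalar x n s) = (scalars s)(x := n)"
  "arrays (set_scalar x n s) = arrays s"
  "scalars (set_array a i j n s) = scalars s"
  "arrays (set_array a i j n s) = (arrays s)(a := (arrays s a)(i := (arrays s a i)(j := n)))"
  by (simp_all add: set_scalar_def set_array_def)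

text \<open>
  In a frame \<open>(w, c, i, Q)\<close>, the spin of \<open>w\<close> is to be sampled given the pins \<open>Q\<close>, and the current
  attempt has proposed \<open>c\<close> and reached the \<open>i\<close>-th neighbour. The top frame comes first.
\<close>

type_synonym frame = "nat \<times> nat \<times> nat \<times> (nat \<times> nat) list"

definition ghosts :: "frame list \<Rightarrow> nat set" where
  "ghosts fs = fst ` set fs"

fun frames_rep :: "state \<Rightarrow> frame list \<Rightarrow> bool" where
  "frames_rep s [] \<longleftrightarrow> True"
| "frames_rep s ((v, c, i, Q) # fs) \<longleftrightarrow>
     arrays s ''sv'' (Suc (length fs)) 0 = v \<and> arrays s ''sc'' (Suc (length fs)) 0 = c \<and>
     arrays s ''si'' (Suc (length fs)) 0 = i \<and> arrays s ''sh'' (Suc (length fs)) 0 = length Q \<and>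
     frames_rep s fs"

definition trail_rep :: "state \<Rightarrow> (nat \<times> nat) list \<Rightarrow> bool" where
  "trail_rep s P \<longleftrightarrow> (\<forall>j<length P. arrays s ''trail'' j 0 = fst (P ! j) \<and>
     arrays s ''pos'' (fst (P ! j)) 0 = j \<and> arrays s ''output'' (fst (P ! j)) 0 = snd (P ! j))"

section \<open>Stability of the memory representation\<close>

lemma frames_rep_cong:
  "(\<And>a j. a \<in> {''sv'', ''sc'', ''si'', ''sh''} \<Longrightarrow> j \<le> length fs \<Longrightarrow> arrays s a j 0 = arrays s' a j 0) \<Longrightarrow>
     frames_rep s fs \<longleftrightarrow> frames_rep s' fs"
proof (induction fs)
  case (Cons fr fs)
  obtain v c i Q where [simp]: "fr = (v, c, i, Q)" by (cases fr)
  have "frames_rep s fs \<longleftrightarrow> frames_rep s' fs" by (rule Cons.IH) (use Cons.prems in auto)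
  then show ?case using Cons.prems[of _ "Suc (length fs)"] by simp
qed simp

lemma frames_rep_set_scalar [simp]: "frames_rep (set_scalar x n s) fs = frames_rep s fs"
  by (rule frames_rep_cong) simp

lemma frames_rep_set_array:
  "a \<notin> {''sv'', ''sc'', ''si'', ''sh''} \<or> length fs < i \<Longrightarrow>
     frames_rep (set_array a i j n s) fs = frames_rep s fs"
  by (rule frames_rep_cong) auto

lemma trail_rep_set_scalar [simp]: "trail_rep (set_scalar x n s) P = trail_rep s P"
  by (simp add: trail_rep_def)

lemma trail_rep_set_array:
  "a \<notin> {''trail'', ''pos'', ''output''} \<Longrightarrow> trail_rep (set_array a i j n s) P = trail_rep s P"
  by (auto simp: trail_rep_def)

text \<open>This is why unpinning requires no writes to the arrays: lowering the length is
  enough.\<close>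

lemma trail_rep_prefix: "trail_rep s (P @ M) \<Longrightarrow> trail_rep s P"
proof -
  assume P: "trail_rep s (P @ M)"
  have "(P @ M) ! j = P ! j" "j < length (P @ M)" if "j < length P" for j
    using that by (simp_all add: nth_append)
  then show ?thesis using P unfolding trail_rep_def by metis
qed

text \<open>The array \<open>pos\<close> is a left inverse of the trail.\<close>

lemma trail_rep_distinct: "trail_rep s P \<Longrightarrow> distinct (map fst P)"
proof -
  assume P: "trail_rep s P"
  have "inj_on (\<lambda>j. fst (P ! j)) {..<length P}"
    by (rule inj_on_inverseI[where g = "\<lambda>u. arrays s ''pos'' u 0"]) (use P in \<open>simp add: trail_rep_def\<close>)
  then show ?thesis by (auto simp: distinct_conv_nth inj_on_def)
qed

section \<open>The potential\<close>

locale soft_sampler = soft_spin_system +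
  fixes \<kappa> :: real and f :: "(nat \<Rightarrow> nat) \<Rightarrow> real" and xs :: "nat list"
  assumes \<kappa>: "\<kappa> \<ge> 0" and f: "\<And>\<tau>. f \<tau> \<ge> 0" and xs: "distinct xs" "set xs \<subseteq> verts S"
begin

text \<open>\<open>K\<close> bounds the number of steps other than \<open>Draw\<close> in one execution of the loop body.\<close>

definition K :: real where
  "K = 40"

text \<open>A bound on the time of one call. It solves (1 + \<delta>) / 2 * T = (1 - \<delta>) / 2 *
  T + 4 K \<Delta> + log q: the success probability times T has to cover the recursive calls and the
  direct work of one attempt.\<close>

definition T :: real where
  "T = (4 * K * real (max_degree S) + log 2 (real q)) / \<delta>"

text \<open>Each vertex still to be sampled is charged one call and one loop execution; the final 1
  pays for the last loop test.\<close>

definition main_val :: "(nat \<times> nat) list \<Rightarrow> real" where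
  "main_val P = \<kappa> * (real (length xs - length P) * (T + K) + 1) +
     cond_exp {} P (\<lambda>\<sigma>. f (restrict \<sigma> (set xs)))"

definition call_val :: "nat set \<Rightarrow> (nat \<times> nat) list \<Rightarrow> nat \<Rightarrow> (nat \<Rightarrow> real) \<Rightarrow> real" where
  "call_val G Q w k = \<kappa> * T + (\<Sum>c<q. marg G Q w c * k c)"

text \<open>The argument \<open>k\<close> values the returned colour. Each remaining neighbour is
  charged one scan, one check and, with probability \<open>reveal w\<close>, one call; the last
  \<open>K\<close> pays for the return. A rejection restores the full value of the call.\<close>

definition scan_val ::
  "nat set \<Rightarrow> (nat \<times> nat) list \<Rightarrow> nat \<Rightarrow> (nat \<Rightarrow> real) \<Rightarrow> nat \<Rightarrow> nat \<Rightarrow> (nat \<times> nat) list \<Rightarrow> real"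
where
  "scan_val G Q w k c i P =
     \<kappa> * (real (length (adj w) - i) * (2 * K + reveal w * T) + K) +
     accept (insert w G) P w c i * k c + (1 - accept (insert w G) P w c i) * call_val G Q w k"

definition pass :: "nat \<Rightarrow> nat \<Rightarrow> nat \<Rightarrow> nat \<Rightarrow> real" where
  "pass w u c d = 1 - (1 - A w u c d) / reveal w"

definition check_val ::
  "nat set \<Rightarrow> (nat \<times> nat) list \<Rightarrow> nat \<Rightarrow> (nat \<Rightarrow> real) \<Rightarrow> nat \<Rightarrow> nat \<Rightarrow> (nat \<times> nat) list \<Rightarrow> real"
where
  "check_val G Q w k c i P =
     (let b = pass w (adj w ! i) c (pin_val P (adj w ! i)) in
      \<kappa> * K + b * scan_val G Q w k c (Suc i) P + (1 - b) * call_val G Q w k)"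

text \<open>The continuation of a pending call as a function of the colour it returns: a caller
  resumes by testing that spin, and the bottom call resumes the main loop.\<close>

primrec return_val :: "frame list \<Rightarrow> (nat \<times> nat) list \<Rightarrow> nat \<Rightarrow> nat \<Rightarrow> real" where
  "return_val [] P v d = main_val (P @ [(v, d)])"
| "return_val (fr # fs) P v d = (case fr of (w, c, i, Q) \<Rightarrow>
     check_val (ghosts fs) Q w (return_val fs Q w) c i (P @ [(v, d)]))"

section \<open>Superharmonic inequalities for the moves of the algorithm\<close>

lemma K_nonneg: "K \<ge> 0" by (simp add: K_def)

lemma log_q: "log 2 (real q) \<ge> 1"
proof -
  have "log 2 (real q) \<ge> log 2 2" using q by (subst log_le_cancel_iff) auto
  then show ?thesis by simp
qed

lemma T_nonneg: "T \<ge> 0"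
  using log_q \<delta> K_nonneg by (auto simp: T_def)

lemma pass_bounds:
  assumes "w \<in> verts S" "i < length (adj w)" "c < q" "d < q"
  shows "0 \<le> pass w (adj w ! i) c d" "pass w (adj w ! i) c d \<le> 1"
    "(1 - reveal w) + reveal w * pass w (adj w ! i) c d = A w (adj w ! i) c d"
proof -
  have "adj w ! i \<in> neighbours S w" using set_adj[OF assms(1)] assms(2) by force
  then have A: "A w (adj w ! i) c d \<le> 1" "1 - reveal w \<le> A w (adj w ! i) c d"
    using A_bounds assms by auto
  have "reveal w > 0" using reveal_bounds(3)[of w] assms(2) by (cases "adj w") auto
  then show "0 \<le> pass w (adj w ! i) c d" "pass w (adj w ! i) c d \<le> 1"
    "(1 - reveal w) + reveal w * pass w (adj w ! i) c d = A w (adj w ! i) c d"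
    using A by (simp_all add: pass_def field_simps)
qed

lemma accept_nonneg: "w \<in> verts S \<Longrightarrow> c < q \<Longrightarrow> ok_pins P \<Longrightarrow> accept G P w c i \<ge> 0"
  using accept_ge[of w c P G i] \<delta> by simp

text \<open>The sampled spin follows its marginal, so total expectation preserves the mean of
  \<open>f\<close>, while the time budget drops by one call and one loop execution.\<close>

lemma main_val_call:
  assumes "length P < length xs" "v = xs ! length P" "v \<notin> pinned P" "ok_pins P"
  shows "\<kappa> * K + call_val {} P v (return_val [] P v) \<le> main_val P"
proof -
  let ?g = "\<lambda>\<sigma>. f (restrict \<sigma> (set xs))"
  have v: "v \<in> verts S - {} - pinned P" using assms xs by auto
  have len: "real (length xs - length P) = 1 + real (length xs - Suc (length P))"
    using assms(1) by linarith
  have "call_val {} P v (return_val [] P v) = \<kappa> * T + (\<Sum>c<q. marg {} P v c *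
      (\<kappa> * (real (length xs - Suc (length P)) * (T + K) + 1))) +
      (\<Sum>c<q. marg {} P v c * cond_exp {} (P @ [(v, c)]) ?g)"
    by (simp add: call_val_def main_val_def distrib_left sum.distrib)
  also have "\<dots> = \<kappa> * T + \<kappa> * (real (length xs - Suc (length P)) * (T + K) + 1) + cond_exp {} P ?g"
    using total_expectation[OF v assms(4), of ?g] marg_sum[OF v assms(4)]
    by (simp add: sum_distrib_right[symmetric])
  finally show ?thesis by (simp add: main_val_def len algebra_simps)
qed

text \<open>A renewal argument. An attempt succeeds with probability \<open>N\<close> and then
  returns a colour distributed as the marginal; with probability \<open>1 - N\<close> the call
  starts afresh. What remains is that an attempt costs at most \<open>N * T\<close>.\<close>

lemma call_val_start:
  assumes w: "w \<in> verts S - G - pinned Q" and Q: "ok_pins Q"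
  shows "\<kappa> * (K + log 2 (real q)) + (\<Sum>c<q. lam w c * scan_val G Q w k c 0 Q) \<le> call_val G Q w k"
proof -
  define a where "a c = accept (insert w G) Q w c 0" for c
  define N where "N = (\<Sum>c<q. lam w c * a c)"
  define Y where "Y = real (length (adj w)) * (2 * K + reveal w * T) + K"
  have wv: "w \<in> verts S" using w by simp
  have N_ge: "(1 + \<delta>) / 2 \<le> N"
  proof -
    have "(1 + \<delta>) / 2 = (\<Sum>c<q. lam w c * ((1 + \<delta>) / 2))"
      using lam_sum[OF wv] sum_distrib_right[of "lam w" "{..<q}" "(1 + \<delta>) / 2"] by simp
    also have "\<dots> \<le> N" unfolding N_def a_def
      using accept_ge[OF wv _ Q] lam_nonneg[OF wv] by (intro sum_mono mult_left_mono) auto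
    finally show ?thesis .
  qed
  have marg: "lam w c * a c = N * marg G Q w c" if "c < q" for c
    using marg_accept[OF w Q that] N_ge \<delta> by (simp add: N_def a_def)
  have "(\<Sum>c<q. lam w c * scan_val G Q w k c 0 Q) =
      (\<Sum>c<q. lam w c * (\<kappa> * Y) + lam w c * a c * k c + (lam w c - lam w c * a c) * call_val G Q w k)"
    unfolding scan_val_def a_def Y_def by (intro sum.cong) (auto simp: algebra_simps)
  also have "\<dots> = \<kappa> * Y + (\<Sum>c<q. lam w c * a c * k c) + (1 - N) * call_val G Q w k"
    using lam_sum[OF wv]
    by (simp add: sum.distrib sum_distrib_right[symmetric] sum_subtractf N_def)
  also have "(\<Sum>c<q. lam w c * a c * k c) = N * (\<Sum>c<q. marg G Q w c * k c)"
    using marg by (simp add: sum_distrib_left mult.assoc)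
  also have "\<dots> = N * (call_val G Q w k - \<kappa> * T)" by (simp add: call_val_def)
  finally have eq: "(\<Sum>c<q. lam w c * scan_val G Q w k c 0 Q) = \<kappa> * Y - \<kappa> * (N * T) + call_val G Q w k"
    by (simp add: algebra_simps)
  \<comment> \<open>Subcriticality: \<open>N\<close> is at least (1 + \<delta>) / 2, the recursive
    calls take at most (1 - \<delta>) / 2 * T, and the difference \<delta> T covers the direct work
    by the choice of \<open>T\<close>.\<close>
  have "K + log 2 (real q) + Y \<le> N * T"
  proof -
    have "real (length (adj w)) * (reveal w * T) \<le> (1 - \<delta>) / 2 * T"
      using mult_right_mono[OF reveal_bounds(4)[of w] T_nonneg] by (simp add: mult.assoc)
    moreover have "(1 + \<delta>) / 2 * T \<le> N * T" using N_ge T_nonneg by (rule mult_right_mono)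
    moreover have "(1 + \<delta>) / 2 * T = (1 - \<delta>) / 2 * T + (2 * (real (max_degree S) * (2 * K)) + log 2 (real q))"
      using \<delta> by (simp add: T_def field_simps)
    moreover have "real (length (adj w)) * (2 * K) \<le> real (max_degree S) * (2 * K)"
      using length_adj_le[OF wv] K_nonneg by (intro mult_right_mono) auto
    moreover have "2 * K \<le> real (max_degree S) * (2 * K)"
      using \<Delta> K_nonneg mult_right_mono[of 1 "real (max_degree S)" "2 * K"] by simp
    moreover have "a + l + (b + b' + a) \<le> n"
      if "b' \<le> x" "y \<le> n" "y = x + (2 * z + l)" "b \<le> z" "2 * a \<le> z" for a b b' l n x y z :: real
      using that by linarith
    ultimately show ?thesis unfolding Y_def distrib_left by blast
  qed
  from mult_left_mono[OF this \<kappa>] show ?thesis unfolding eq by (simp add: algebra_simps)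
qed

lemma scan_val_Suc:
  assumes "i < length (adj w)"
  shows "scan_val G Q w k c i P =
     \<kappa> * (real (length (adj w) - Suc i) * (2 * K + reveal w * T) + K) + \<kappa> * (2 * K + reveal w * T) +
     accept (insert w G) P w c i * k c + (1 - accept (insert w G) P w c i) * call_val G Q w k"
proof -
  have "real (length (adj w) - i) = 1 + real (length (adj w) - Suc i)" using assms by linarith
  then show ?thesis by (simp add: scan_val_def algebra_simps)
qed

lemma scan_val_ghost:
  assumes "i < length (adj w)" "adj w ! i \<in> insert w G"
  shows "\<kappa> * K + scan_val G Q w k c (Suc i) P \<le> scan_val G Q w k c i P"
proof -
  have "0 \<le> \<kappa> * (K + reveal w * T)"
    using \<kappa> K_nonneg T_nonneg reveal_bounds(1)[of w] by simp
  then show ?thesis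
    unfolding scan_val_Suc[OF assms(1)] accept_ghost[OF assms]
    by (simp add: scan_val_def algebra_simps)
qed

text \<open>Averaging over the reveal coin merges the two biases into the interaction
  \<open>A\<close>, as if the spin had been known. The time for the check and for the later
  neighbours is charged in full, whatever the coins show.\<close>

lemma scan_check_le:
  assumes w: "w \<in> verts S" "c < q" and i: "i < length (adj w)" and P: "ok_pins P"
  shows "(1 - reveal w) * scan_val G Q w k c (Suc i) P + reveal w * check_val G Q w k c i P
    \<le> \<kappa> * (real (length (adj w) - Suc i) * (2 * K + reveal w * T) + K) + \<kappa> * K +
      A w (adj w ! i) c (pin_val P (adj w ! i)) * accept (insert w G) P w c (Suc i) * k c +
      (1 - A w (adj w ! i) c (pin_val P (adj w ! i)) * accept (insert w G) P w c (Suc i)) * call_val G Q w k"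
proof -
  let ?b = "pass w (adj w ! i) c (pin_val P (adj w ! i))"
  let ?A = "A w (adj w ! i) c (pin_val P (adj w ! i))"
  let ?s = "call_val G Q w k" and ?a = "accept (insert w G) P w c (Suc i)"
  let ?Y = "real (length (adj w) - Suc i) * (2 * K + reveal w * T) + K"
  note b = pass_bounds[OF w(1) i w(2) pin_val_less[OF P, of "adj w ! i"]]
  have A1: "?A \<le> 1" using A_bounds(1)[OF w(1) _ w(2) pin_val_less[OF P]] set_adj[OF w(1)] i by force
  have Y: "0 \<le> ?Y" using K_nonneg T_nonneg reveal_bounds(1)[of w] by simp
  have "(1 - reveal w) * scan_val G Q w k c (Suc i) P + reveal w * check_val G Q w k c i P =
      \<kappa> * (reveal w * K) + (1 - reveal w + reveal w * ?b) * scan_val G Q w k c (Suc i) P +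
      (1 - (1 - reveal w + reveal w * ?b)) * ?s"
    by (simp add: check_val_def Let_def algebra_simps)
  also have "\<dots> = \<kappa> * (reveal w * K) + \<kappa> * (?A * ?Y) + ?A * ?a * k c + (1 - ?A * ?a) * ?s"
    unfolding b(3) by (simp add: scan_val_def algebra_simps)
  also have "\<kappa> * (reveal w * K) \<le> \<kappa> * K"
    using \<kappa> K_nonneg reveal_bounds(2)[of w] mult_right_mono[of "reveal w" 1 K] by (intro mult_left_mono) auto
  also have "\<kappa> * (?A * ?Y) \<le> \<kappa> * ?Y"
    using \<kappa> Y mult_right_mono[OF A1 Y] by (intro mult_left_mono) auto
  finally show ?thesis by linarith
qed

lemma scan_val_pinned:
  assumes w: "w \<in> verts S" "c < q" and i: "i < length (adj w)" and P: "ok_pins P"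
    and u: "adj w ! i \<notin> insert w G" "adj w ! i \<in> pinned P"
  shows "\<kappa> * K + (1 - reveal w) * scan_val G Q w k c (Suc i) P + reveal w * check_val G Q w k c i P
    \<le> scan_val G Q w k c i P"
proof -
  have "0 \<le> \<kappa> * (reveal w * T)" using \<kappa> T_nonneg reveal_bounds(1)[of w] by simp
  then show ?thesis
    using scan_check_le[OF w i P, of G Q k]
    unfolding scan_val_Suc[OF i] accept_pinned[OF w(1) i u P, of c] distrib_left by linarith
qed

text \<open>The term \<open>reveal w * T\<close> in \<open>scan_val\<close> pays for the recursive
  call.\<close>

lemma scan_val_free:
  assumes w: "w \<in> verts S" "c < q" and i: "i < length (adj w)" and P: "ok_pins P"
    and u: "u = adj w ! i" "u \<notin> insert w G" "u \<notin> pinned P"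
  shows "\<kappa> * K + (1 - reveal w) * scan_val G Q w k c (Suc i) P +
      reveal w * call_val (insert w G) P u (\<lambda>d. check_val G Q w k c i (P @ [(u, d)]))
    \<le> scan_val G Q w k c i P"
proof -
  let ?M = "marg (insert w G) P u" and ?P = "\<lambda>d. P @ [(u, d)]" and ?s = "call_val G Q w k"
  let ?a = "\<lambda>d. accept (insert w G) (?P d) w c (Suc i)" and ?p = "reveal w"
  let ?Y = "real (length (adj w) - Suc i) * (2 * K + reveal w * T) + K"
  have u': "u \<in> verts S - insert w G - pinned P" using u adj_nth[OF w(1) i] by auto
  have M1: "(\<Sum>d<q. ?M d) = 1" by (rule marg_sum[OF u' P])
  have M: "(\<Sum>d<q. ?M d * (x + y d)) = x + (\<Sum>d<q. ?M d * y d)" for x y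
    by (simp add: distrib_left sum.distrib sum_distrib_right[symmetric] M1)
  \<comment> \<open>When the coin hides the spin of \<open>u\<close>, it is never sampled, but the
    analysis may still average over it. Both outcomes of the coin can then be combined spin by
    spin.\<close>
  have scan: "scan_val G Q w k c (Suc i) P = (\<Sum>d<q. ?M d * scan_val G Q w k c (Suc i) (?P d))"
  proof -
    have acc: "accept (insert w G) P w c (Suc i) = (\<Sum>d<q. ?M d * ?a d)"
      unfolding accept_def by (rule total_expectation[OF u' P])
    have eq: "scan_val G Q w k c (Suc i) P' =
        \<kappa> * ?Y + ?s + accept (insert w G) P' w c (Suc i) * (k c - ?s)" for P'
      by (simp add: scan_val_def algebra_simps)
    have "(\<Sum>d<q. ?M d * scan_val G Q w k c (Suc i) (?P d)) =
        (\<Sum>d<q. ?M d * (\<kappa> * ?Y + ?s + ?a d * (k c - ?s)))"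
      by (intro sum.cong refl arg_cong2[where f = "(*)"] eq)
    also have "\<dots> = \<kappa> * ?Y + ?s + (\<Sum>d<q. ?M d * ?a d) * (k c - ?s)"
      unfolding sum_distrib_right mult.assoc by (rule M)
    also have "\<dots> = scan_val G Q w k c (Suc i) P"
      unfolding acc[symmetric] by (rule eq[symmetric])
    finally show ?thesis by (rule sym)
  qed
  have ok: "ok_pins (?P d)" if "d < q" for d using P u' that by simp
  have v: "pin_val (?P d) (adj w ! i) = d" for d using u by (simp add: pin_val_snoc)
  have split: "(1 - ?p) * scan_val G Q w k c (Suc i) P +
      ?p * call_val (insert w G) P u (\<lambda>d. check_val G Q w k c i (?P d)) =
      \<kappa> * (?p * T) + (\<Sum>d<q. ?M d * ((1 - ?p) * scan_val G Q w k c (Suc i) (?P d) + ?p * check_val G Q w k c i (?P d)))"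
    unfolding scan call_val_def[of "insert w G"]
    by (simp add: distrib_left sum.distrib sum_distrib_left mult_ac)
  have "(\<Sum>d<q. ?M d * ((1 - ?p) * scan_val G Q w k c (Suc i) (?P d) + ?p * check_val G Q w k c i (?P d)))
      \<le> (\<Sum>d<q. ?M d * (\<kappa> * ?Y + \<kappa> * K + A w u c d * ?a d * k c + (1 - A w u c d * ?a d) * ?s))"
    using scan_check_le[OF w i ok, of _ G Q k] marg_nonneg[OF P]
    by (intro sum_mono mult_left_mono) (simp_all add: v[folded u(1)] u(1)[symmetric])
  also have "\<dots> = (\<Sum>d<q. ?M d * (\<kappa> * ?Y + \<kappa> * K + ?s + (A w u c d * ?a d) * (k c - ?s)))"
    by (intro sum.cong) (simp_all add: algebra_simps)
  also have "\<dots> = \<kappa> * ?Y + \<kappa> * K + ?s + accept (insert w G) P w c i * (k c - ?s)"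
    unfolding accept_free[OF w(1) i u'[unfolded u(1)] P, of c, folded u(1)] sum_distrib_right mult.assoc
    by (rule M)
  finally show ?thesis using split unfolding scan_val_Suc[OF i] by (simp add: algebra_simps)
qed

lemma scan_val_accept:
  assumes "length (adj w) \<le> i" "ok_pins P"
  shows "\<kappa> * K + k c \<le> scan_val G Q w k c i P"
  using assms by (simp add: scan_val_def accept_end)

section \<open>Nonnegativity of the values\<close>

lemma main_val_nonneg: "ok_pins P \<Longrightarrow> main_val P \<ge> 0"
proof -
  assume P: "ok_pins P"
  have "cond_exp {} P (\<lambda>\<sigma>. f (restrict \<sigma> (set xs))) \<ge> 0"
    using cond_exp_mono[of "{}" "\<lambda>_. 0" "\<lambda>\<sigma>. f (restrict \<sigma> (set xs))" P] f P by (simp add: cond_exp_const)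
  then show ?thesis unfolding main_val_def using \<kappa> T_nonneg K_nonneg by simp
qed

lemma call_val_nonneg: "ok_pins Q \<Longrightarrow> (\<And>c. c < q \<Longrightarrow> k c \<ge> 0) \<Longrightarrow> call_val G Q w k \<ge> 0"
  unfolding call_val_def using \<kappa> T_nonneg marg_nonneg
  by (intro add_nonneg_nonneg sum_nonneg mult_nonneg_nonneg) auto

lemma scan_val_nonneg:
  assumes "w \<in> verts S" "c < q" "ok_pins P" "ok_pins Q" "\<And>c. c < q \<Longrightarrow> k c \<ge> 0"
  shows "scan_val G Q w k c i P \<ge> 0"
  unfolding scan_val_def
  using \<kappa> T_nonneg K_nonneg reveal_bounds(1)[of w] call_val_nonneg[of Q k] assms
    accept_nonneg accept_le_1
  by (intro add_nonneg_nonneg mult_nonneg_nonneg) auto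

lemma check_val_nonneg:
  assumes "w \<in> verts S" "c < q" "i < length (adj w)" "ok_pins P" "ok_pins Q" "\<And>c. c < q \<Longrightarrow> k c \<ge> 0"
  shows "check_val G Q w k c i P \<ge> 0"
  unfolding check_val_def Let_def
  using \<kappa> K_nonneg call_val_nonneg[of Q k] scan_val_nonneg[of w c P Q k] assms
    pass_bounds[OF assms(1,3,2) pin_val_less[OF assms(4)]]
  by (intro add_nonneg_nonneg mult_nonneg_nonneg) auto

section \<open>The memory invariant and the potential\<close>

lemma trail_rep_nth:
  assumes "trail_rep s P" "j < length P"
  shows "arrays s ''trail'' j 0 = fst (P ! j)" "arrays s ''pos'' (fst (P ! j)) 0 = j"
    "arrays s ''output'' (fst (P ! j)) 0 = snd (P ! j)"
  using assms unfolding trail_rep_def by blast+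

lemma pinned_conv_nth: "u \<in> pinned P \<longleftrightarrow> (\<exists>j<length P. fst (P ! j) = u)"
  unfolding pinned_def by (metis fst_conv image_iff in_set_conv_nth)

lemma trail_rep_pinned:
  assumes "trail_rep s P"
  shows "arrays s ''pos'' u 0 < length P \<and> arrays s ''trail'' (arrays s ''pos'' u 0) 0 = u \<longleftrightarrow> u \<in> pinned P"
  using trail_rep_nth(1,2)[OF assms] unfolding pinned_conv_nth by metis

lemma trail_rep_output:
  assumes "trail_rep s P" "u \<in> pinned P"
  shows "arrays s ''output'' u 0 = pin_val P u"
proof -
  obtain j where j: "j < length P" "fst (P ! j) = u" using assms(2) unfolding pinned_conv_nth by blast
  have "(u, snd (P ! j)) \<in> set P" using j nth_mem[OF j(1)] by (metis prod.collapse)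
  then have "pin_val P u = snd (P ! j)"
    using trail_rep_distinct[OF assms(1)] by (intro pin_val_mem)
  then show ?thesis using trail_rep_nth(3)[OF assms(1) j(1)] j(2) by simp
qed

text \<open>The pins \<open>Q\<close> of a frame are the whole trail that the frame below had when
  it made the call. The \<open>case\<close> records the reason for the call: the next input vertex,
  or the neighbour at which the frame below is waiting.\<close>

fun stack_ok :: "nat \<Rightarrow> frame list \<Rightarrow> (nat \<times> nat) list \<Rightarrow> bool" where
  "stack_ok k [] P \<longleftrightarrow> map fst P = take k xs \<and> k \<le> length xs"
| "stack_ok k ((v, c, i, Q) # fs) P \<longleftrightarrow>
     (\<exists>M. P = Q @ M) \<and> v \<in> verts S \<and> v \<notin> ghosts fs \<and> v \<notin> pinned Q \<and> stack_ok k fs Q \<and>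
     (case fs of [] \<Rightarrow> k < length xs \<and> v = xs ! k
      | (w, c', i', Q') # _ \<Rightarrow> c' < q \<and> i' < length (adj w) \<and> v = adj w ! i')"

definition rep :: "nat \<Rightarrow> state \<Rightarrow> frame list \<Rightarrow> (nat \<times> nat) list \<Rightarrow> bool" where
  "rep k s fs P \<longleftrightarrow>
     scalars s ''m'' = length xs \<and> (\<forall>j<length xs. arrays s ''input'' j 0 = xs ! j) \<and>
     scalars s ''d'' = length fs \<and> scalars s ''t'' = length P \<and> scalars s ''k'' = k \<and>
     (\<forall>u. arrays s ''ghost'' u 0 = of_bool (u \<in> ghosts fs)) \<and> trail_rep s P \<and> frames_rep s fs \<and>
     ok_pins P \<and> stack_ok k fs P"

text \<open>At the start of an attempt the value depends on \<open>Q\<close> alone, since the later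
  pins are about to be dropped.\<close>

inductive config_val :: "state \<Rightarrow> real \<Rightarrow> bool" where
  config_main: "rep k s [] P \<Longrightarrow> config_val s (main_val P)"
| config_call: "rep k s ((w, c, i, Q) # fs) P \<Longrightarrow> scalars s ''f'' = 0 \<Longrightarrow>
     config_val s (call_val (ghosts fs) Q w (return_val fs Q w))"
| config_scan: "rep k s ((w, c, i, Q) # fs) P \<Longrightarrow> scalars s ''f'' = 1 \<Longrightarrow> c < q \<Longrightarrow>
     config_val s (scan_val (ghosts fs) Q w (return_val fs Q w) c i P)"
| config_check: "rep k s ((w, c, i, Q) # fs) P \<Longrightarrow> scalars s ''f'' = 2 \<Longrightarrow> c < q \<Longrightarrow>
     i < length (adj w) \<Longrightarrow> adj w ! i \<in> pinned P \<Longrightarrow>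
     config_val s (check_val (ghosts fs) Q w (return_val fs Q w) c i P)"

text \<open>The infimum makes it unnecessary to show that a memory represents only one
  configuration. A memory that represents none gets the value infinity and imposes no condition on
  the loop.\<close>

definition potential :: "state \<Rightarrow> ennreal" where
  "potential s = (INF x\<in>{x. config_val s x}. ennreal x)"

lemma stack_ok_return_val_nonneg:
  "stack_ok k ((v, c, i, Q) # fs) P \<Longrightarrow> ok_pins P \<Longrightarrow> d < q \<Longrightarrow> return_val fs Q v d \<ge> 0"
proof (induction fs arbitrary: v c i Q P d)
  case Nil
  then show ?case by (auto intro!: main_val_nonneg)
next
  case (Cons fr fs)
  obtain w c' i' Q' where fr [simp]: "fr = (w, c', i', Q')" by (cases fr)
  have "return_val fs Q' w d' \<ge> 0" if "d' < q" for d'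
    using Cons.IH[of w c' i' Q' Q d'] Cons.prems that by auto
  then show ?case using Cons.prems by (auto intro!: check_val_nonneg)
qed

lemma config_val_nonneg: "config_val s x \<Longrightarrow> x \<ge> 0"
proof (induction rule: config_val.induct)
  case (config_main k s P)
  then show ?case by (auto simp: rep_def intro!: main_val_nonneg)
next
  case (config_call k s w c i Q fs P)
  then show ?case
    using stack_ok_return_val_nonneg[of k w c i Q fs P]
    by (auto simp: rep_def intro!: call_val_nonneg)
next
  case (config_scan k s w c i Q fs P)
  then show ?case
    using stack_ok_return_val_nonneg[of k w c i Q fs P]
    by (auto simp: rep_def intro!: scan_val_nonneg)
next
  case (config_check k s w c i Q fs P)
  then show ?case
    using stack_ok_return_val_nonneg[of k w c i Q fs P]
    by (auto simp: rep_def intro!: check_val_nonneg)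
qed

lemma bounded_by_potential: "config_val s x \<Longrightarrow> x \<le> y \<Longrightarrow> bounded_by (potential s) y"
proof -
  assume x: "config_val s x" "x \<le> y"
  have "potential s \<le> ennreal x" unfolding potential_def using x by (intro INF_lower) simp
  also have "\<dots> \<le> ennreal y" using x by (intro ennreal_leI)
  finally show ?thesis using config_val_nonneg[OF x(1)] x by (simp add: bounded_by_def)
qed

lemma ghosts_simps [simp]: "ghosts [] = {}" "ghosts ((v, c, i, Q) # fs) = insert v (ghosts fs)"
  by (auto simp: ghosts_def)

lemma trail_rep_snoc:
  assumes "trail_rep s P" "v \<notin> pinned P"
  shows "trail_rep (set_array ''output'' v 0 c (set_array ''pos'' v 0 (length P)
     (set_array ''trail'' (length P) 0 v s))) (P @ [(v, c)])"
proof -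
  have "fst (P ! j) \<noteq> v" if "j < length P" for j
    using assms(2) that unfolding pinned_conv_nth by blast
  then show ?thesis using assms(1) by (auto simp: trail_rep_def nth_append less_Suc_eq)
qed

section \<open>Preservation of the invariant\<close>

lemma rep_set_scalar:
  "x \<notin> {''m'', ''d'', ''t'', ''k''} \<Longrightarrow> rep k (set_scalar x n s) fs P = rep k s fs P"
  by (auto simp: rep_def)

text \<open>The new frame shows whatever colour and index the arrays held before; the first proposal
  overwrites them.\<close>

lemma rep_call:
  assumes "rep k s fs P" "u \<in> verts S" "u \<notin> ghosts fs" "u \<notin> pinned P"
    "case fs of [] \<Rightarrow> k < length xs \<and> u = xs ! k
      | (w, c', i', Q') # _ \<Rightarrow> c' < q \<and> i' < length (adj w) \<and> u = adj w ! i'"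
  shows "rep k (set_scalar ''d'' (Suc (length fs)) (set_array ''ghost'' u 0 1
      (set_array ''sh'' (Suc (length fs)) 0 (length P) (set_array ''sv'' (Suc (length fs)) 0 u s))))
    ((u, arrays s ''sc'' (Suc (length fs)) 0, arrays s ''si'' (Suc (length fs)) 0, P) # fs) P"
  using assms by (auto simp: rep_def frames_rep_set_array trail_rep_set_array)

lemma rep_advance:
  assumes "rep k s ((w, c, i, Q) # fs) P"
  shows "rep k (set_array ''si'' (Suc (length fs)) 0 i' s) ((w, c, i', Q) # fs) P"
  using assms by (auto simp: rep_def frames_rep_set_array trail_rep_set_array)

lemma rep_propose:
  assumes "rep k s ((w, c, i, Q) # fs) P"
  shows "rep k (set_array ''si'' (Suc (length fs)) 0 i' (set_array ''sc'' (Suc (length fs)) 0 c'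
      (set_scalar ''x'' n (set_scalar ''t'' (length Q) s)))) ((w, c', i', Q) # fs) Q"
  using assms by (auto simp: rep_def frames_rep_set_array trail_rep_set_array intro: trail_rep_prefix)

lemma rep_return:
  assumes rep: "rep k s ((w, c, i, Q) # fs) P" and c: "c < q"
  defines "s' \<equiv> set_scalar ''d'' (length fs) (set_scalar ''t'' (Suc (length Q))
      (set_array ''ghost'' w 0 0 (set_array ''output'' w 0 c (set_array ''pos'' w 0 (length Q)
        (set_array ''trail'' (length Q) 0 w (set_scalar ''t'' (length Q) s))))))"
  shows "fs = [] \<Longrightarrow> rep (Suc k) (set_scalar ''k'' (Suc k) s') [] (Q @ [(w, c)])"
    "fs \<noteq> [] \<Longrightarrow> rep k s' fs (Q @ [(w, c)])"
proof -
  obtain M where P: "P = Q @ M" using rep by (auto simp: rep_def)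
  have w: "w \<notin> pinned Q" "w \<notin> ghosts fs" using rep by (auto simp: rep_def)
  have trail: "trail_rep s' (Q @ [(w, c)])"
    using trail_rep_snoc[of s Q w c] trail_rep_prefix[of s Q M] rep w
    by (simp add: s'_def rep_def P trail_rep_set_array) (simp add: trail_rep_def)
  have frames: "frames_rep s' fs"
    using rep by (simp add: s'_def rep_def frames_rep_set_array)
  show "rep (Suc k) (set_scalar ''k'' (Suc k) s') [] (Q @ [(w, c)])" if "fs = []"
    using rep c trail frames that by (auto simp: rep_def P s'_def take_Suc_conv_app_nth)
  show "rep k s' fs (Q @ [(w, c)])" if "fs \<noteq> []"
    using rep c w trail frames that by (cases fs) (auto simp: rep_def P s'_def)
qed

lemma main_pins_unvisited:
  assumes "rep k s [] P" "k < length xs"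
  shows "length P = k" "xs ! k \<in> verts S" "xs ! k \<notin> pinned P"
proof -
  have P: "map fst P = take k xs" using assms by (simp add: rep_def)
  from arg_cong[OF this, of length] show "length P = k" using assms(2) by simp
  show "xs ! k \<in> verts S" using xs assms(2) by auto
  have "pinned P = set (take k xs)" unfolding pinned_def P[symmetric] by simp
  then show "xs ! k \<notin> pinned P"
    using xs(1) assms(2) by (auto simp: in_set_conv_nth nth_eq_iff_index_eq)
qed

section \<open>One execution of the loop body in each kind of configuration\<close>

lemma K_mult: "\<kappa> * K = 40 * \<kappa>"
  by (simp add: K_def)

abbreviation "ec \<equiv> expected_cost S adj (ennreal \<kappa>)"

text \<open>Five writes and four sequencings give 9 steps. The expression \<open>a\<close> is
  evaluated twice, the second time after two of the writes.\<close>

lemma bounded_by_call: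
  assumes rep: "rep k s fs P" and u: "u \<in> verts S" "u \<notin> ghosts fs" "u \<notin> pinned P"
    "case fs of [] \<Rightarrow> k < length xs \<and> u = xs ! k
      | (w, c', i', Q') # _ \<Rightarrow> c' < q \<and> i' < length (adj w) \<and> u = adj w ! i'"
    and a: "aval adj a s = u"
      "aval adj a (set_array ''sh'' (Suc (length fs)) 0 (length P) (set_array ''sv'' (Suc (length fs)) 0 u s)) = u"
    and y: "9 * \<kappa> + call_val (ghosts fs) P u (return_val fs P u) \<le> y"
  shows "bounded_by (ec (call a) potential s) y"
proof -
  let ?s = "set_scalar ''f'' 0 (set_scalar ''d'' (Suc (length fs)) (set_array ''ghost'' u 0 1
      (set_array ''sh'' (Suc (length fs)) 0 (length P) (set_array ''sv'' (Suc (length fs)) 0 u s))))"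
  have "scalars s ''d'' = length fs" "scalars s ''t'' = length P" using rep by (auto simp: rep_def)
  moreover have "config_val ?s (call_val (ghosts fs) P u (return_val fs P u))"
    by (rule config_call) (use rep_call[OF rep u] in \<open>simp_all add: rep_set_scalar\<close>)
  ultimately show ?thesis
    using y \<kappa> by (simp add: call_def a) (intro bounded_by_add, rule bounded_by_potential, simp, linarith+)
qed

lemma step_main:
  assumes rep: "rep k s [] P" and k: "k < length xs"
  shows "bounded_by (ennreal \<kappa> + ec (body \<delta>) potential s) (main_val P)"
proof -
  note u = main_pins_unvisited[OF rep k]
  have s: "scalars s ''d'' = 0" "scalars s ''k'' = k" "arrays s ''input'' k 0 = xs ! k" "ok_pins P"
    using rep k by (auto simp: rep_def)
  have "\<kappa> * K + call_val {} P (xs ! k) (return_val [] P (xs ! k)) \<le> main_val P"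
    by (rule main_val_call) (use u k s in auto)
  then have *: "bounded_by (ec (call (Arr ''input'' (V ''k'') (N 0))) potential s) (main_val P - \<kappa> - \<kappa>)"
    by (intro bounded_by_call[OF rep, of "xs ! k"]) (use u k s \<kappa> in \<open>auto simp: K_def simp del: return_val.simps\<close>)
  show ?thesis
    by (simp add: body_def s) (intro bounded_by_add \<kappa> *)
qed

lemma step_call:
  assumes rep: "rep k s ((w, c, i, Q) # fs) P" and f: "scalars s ''f'' = 0"
  shows "bounded_by (ennreal \<kappa> + ec (body \<delta>) potential s) (call_val (ghosts fs) Q w (return_val fs Q w))"
proof -
  let ?k = "return_val fs Q w"
  have s: "scalars s ''d'' = Suc (length fs)" "arrays s ''sv'' (Suc (length fs)) 0 = w"
    "arrays s ''sh'' (Suc (length fs)) 0 = length Q" and w: "w \<in> verts S - ghosts fs - pinned Q" "ok_pins Q"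
    using rep by (auto simp: rep_def)
  have *: "config_val (set_scalar ''f'' (Suc 0) (set_array ''si'' (Suc (length fs)) 0 0 (set_array ''sc'' (Suc (length fs)) 0 c'
      (set_scalar ''x'' c' (set_scalar ''t'' (length Q) s))))) (scan_val (ghosts fs) Q w ?k c' 0 Q)" if "c' < q" for c'
    by (rule config_scan) (use rep_propose[OF rep] that in \<open>simp_all add: rep_set_scalar\<close>)
  \<comment> \<open>Six unit steps, including the loop test, precede the draw and five follow it;
    together they stay below \<open>K\<close>.\<close>
  have "(\<Sum>c<q. lam w c * (5 * \<kappa> + scan_val (ghosts fs) Q w ?k c 0 Q)) =
      5 * \<kappa> + (\<Sum>c<q. lam w c * scan_val (ghosts fs) Q w ?k c 0 Q)"
    using lam_sum[of w] w by (simp add: distrib_left sum.distrib sum_distrib_right[symmetric])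
  also have "\<dots> \<le> call_val (ghosts fs) Q w ?k - 6 * \<kappa> - \<kappa> * log 2 (real q)"
    using call_val_start[OF w, of ?k] \<kappa> by (simp add: K_def algebra_simps)
  finally have le: "(\<Sum>c<q. lam w c * (5 * \<kappa> + scan_val (ghosts fs) Q w ?k c 0 Q))
      \<le> call_val (ghosts fs) Q w ?k - 6 * \<kappa> - \<kappa> * log 2 (real q)" .
  show ?thesis
    apply (simp add: body_def s f propose_def top_entry_def)
    apply (intro bounded_by_add bounded_by_add_mult \<kappa>)
     apply (rule bounded_by_field_pmf[where y = "\<lambda>c. 5 * \<kappa> + scan_val (ghosts fs) Q w ?k c 0 Q"])
    subgoal using w by simp
    subgoal by (intro bounded_by_add \<kappa>, rule bounded_by_potential[OF *]) simp_all
    subgoal using le by simp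
    subgoal using log_q by simp
    done
qed

lemma step_check:
  assumes rep: "rep k s ((w, c, i, Q) # fs) P" and f: "scalars s ''f'' = 2" and c: "c < q"
    and i: "i < length (adj w)" "adj w ! i \<in> pinned P"
  shows "bounded_by (ennreal \<kappa> + ec (body \<delta>) potential s)
    (check_val (ghosts fs) Q w (return_val fs Q w) c i P)"
proof -
  let ?k = "return_val fs Q w" and ?b = "pass w (adj w ! i) c (pin_val P (adj w ! i))"
  have s: "scalars s ''d'' = Suc (length fs)" "arrays s ''sv'' (Suc (length fs)) 0 = w"
    "arrays s ''sc'' (Suc (length fs)) 0 = c" "arrays s ''si'' (Suc (length fs)) 0 = i"
    "arrays s ''output'' (adj w ! i) 0 = pin_val P (adj w ! i)" and w: "w \<in> verts S" and P: "ok_pins P"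
    using rep i trail_rep_output by (auto simp: rep_def)
  note b = pass_bounds(1,2)[OF w i(1) c pin_val_less[OF P, of "adj w ! i"]]
  have 1: "config_val (set_scalar ''f'' (Suc 0) (set_array ''si'' (Suc (length fs)) 0 (Suc i) (set_scalar ''x'' n s)))
      (scan_val (ghosts fs) Q w ?k c (Suc i) P)" for n
    by (rule config_scan) (use rep_advance[of k "set_scalar ''x'' n s"] rep c in \<open>simp_all add: rep_set_scalar\<close>)
  have 0: "config_val (set_scalar ''f'' 0 (set_scalar ''x'' n s)) (call_val (ghosts fs) Q w ?k)" for n
    by (rule config_call) (use rep in \<open>simp_all add: rep_set_scalar\<close>)
  have val: "rval S adj (pass_exp \<delta>) s = ?b"
    by (simp add: pass_exp_def reveal_exp_def next_nb_def top_entry_def s i pass_def reveal_def)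
  show ?thesis
    apply (simp add: body_def s f check_def val advance_def top_entry_def del: nn_integral_bernoulli_pmf)
    apply (intro bounded_by_add \<kappa>)
     apply (rule bounded_by_bernoulli[where ?y1.0 = "5 * \<kappa> + scan_val (ghosts fs) Q w ?k c (Suc i) P" and
          ?y0.0 = "5 * \<kappa> + call_val (ghosts fs) Q w ?k"])
    subgoal by (simp add: s) (intro bounded_by_add \<kappa>, rule bounded_by_potential[OF 1], simp_all add: \<kappa>)
    subgoal using \<kappa> by (simp add: s) (intro bounded_by_add \<kappa>, rule bounded_by_potential[OF 0], simp_all add: \<kappa>)
    subgoal by (rule b)
    subgoal by (rule b)
    subgoal using \<kappa> by (simp add: check_val_def Let_def K_def algebra_simps)
    done
qed

lemma rep_top:
  assumes "rep k s ((w, c, i, Q) # fs) P"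
  shows "scalars s ''d'' = Suc (length fs)" "arrays s ''sv'' (Suc (length fs)) 0 = w"
    "arrays s ''sc'' (Suc (length fs)) 0 = c" "arrays s ''si'' (Suc (length fs)) 0 = i"
    "arrays s ''sh'' (Suc (length fs)) 0 = length Q" "scalars s ''k'' = k"
    "arrays s ''ghost'' u 0 = of_bool (u \<in> insert w (ghosts fs))"
    "w \<in> verts S" "ok_pins P" "trail_rep s P" "scalars s ''t'' = length P"
  using assms by (auto simp: rep_def)

lemma step_return:
  assumes rep: "rep k s ((w, c, i, Q) # fs) P" and f: "scalars s ''f'' = 1" and c: "c < q"
    and i: "length (adj w) \<le> i"
  shows "bounded_by (ennreal \<kappa> + ec (body \<delta>) potential s)
    (scan_val (ghosts fs) Q w (return_val fs Q w) c i P)"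
proof -
  let ?k = "return_val fs Q w" and ?X = "scan_val (ghosts fs) Q w (return_val fs Q w) c i P"
  have val: "40 * \<kappa> + ?k c \<le> ?X"
    using scan_val_accept[OF i rep_top(9)[OF rep]] by (simp add: K_mult)
  show ?thesis
  proof (cases "fs = []")
    case True
    note * = config_main[OF rep_return(1)[OF rep c True]]
    show ?thesis
      using i
      apply (simp add: body_def scan_def f rep_top[OF rep, unfolded True list.size] top_entry_def return_def True)
      apply (intro bounded_by_add \<kappa>)
      apply (rule bounded_by_potential)
      using * True
      apply simp
      using \<kappa> val
      apply (simp add: True)
      done
  next
    case False
    then obtain u d j Q' fs' where fs: "fs = (u, d, j, Q') # fs'" by (cases fs) auto
    have "config_val (set_scalar ''f'' 2 (set_scalar ''d'' (length fs) (set_scalar ''t'' (Suc (length Q))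
        (set_array ''ghost'' w 0 0 (set_array ''output'' w 0 c (set_array ''pos'' w 0 (length Q)
        (set_array ''trail'' (length Q) 0 w (set_scalar ''t'' (length Q) s)))))))) (?k c)"
      using rep_return(2)[OF rep c False] rep unfolding fs return_val.simps prod.case
      by (intro config_check[where k = k]) (auto simp: rep_set_scalar rep_def)
    note * = bounded_by_potential[OF this]
    show ?thesis
      using i False
      apply (simp add: body_def scan_def f rep_top[OF rep] top_entry_def return_def)
      apply (intro bounded_by_add \<kappa>)
      apply (rule *)
      using \<kappa> val
      apply simp
      done
  qed
qed

lemma step_ghost:
  assumes rep: "rep k s ((w, c, i, Q) # fs) P" and f: "scalars s ''f'' = 1" and c: "c < q"
    and i: "i < length (adj w)" "adj w ! i \<in> insert w (ghosts fs)"
  shows "bounded_by (ennreal \<kappa> + ec (body \<delta>) potential s)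
    (scan_val (ghosts fs) Q w (return_val fs Q w) c i P)"
proof -
  let ?k = "return_val fs Q w"
  have 1: "config_val (set_array ''si'' (Suc (length fs)) 0 (Suc i) s)
      (scan_val (ghosts fs) Q w ?k c (Suc i) P)"
    by (rule config_scan) (use rep_advance[OF rep] f c in simp_all)
  have val: "40 * \<kappa> + scan_val (ghosts fs) Q w ?k c (Suc i) P \<le> scan_val (ghosts fs) Q w ?k c i P"
    using scan_val_ghost[OF i] by (simp add: K_mult)
  show ?thesis
    using i
    apply (simp add: body_def scan_def f rep_top[OF rep] top_entry_def next_nb_def advance_def)
    apply (intro bounded_by_add \<kappa>)
    apply (rule bounded_by_potential[OF 1])
    using \<kappa> val
    apply simp
    done
qed

lemma step_visit:
  assumes rep: "rep k s ((w, c, i, Q) # fs) P" and f: "scalars s ''f'' = 1" and c: "c < q"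
    and i: "i < length (adj w)" "adj w ! i \<notin> insert w (ghosts fs)"
  shows "bounded_by (ennreal \<kappa> + ec (body \<delta>) potential s)
    (scan_val (ghosts fs) Q w (return_val fs Q w) c i P)"
proof -
  let ?k = "return_val fs Q w" and ?u = "adj w ! i"
  let ?scan = "scan_val (ghosts fs) Q w ?k c"
  note rep' = rep_top[OF rep]
  have u: "?u \<in> verts S" "?u \<noteq> w" using adj_nth[OF rep'(8) i(1)] by auto
  have 1: "config_val (set_array ''si'' (Suc (length fs)) 0 (Suc i) (set_scalar ''x'' n s))
      (?scan (Suc i) P)" for n
    by (rule config_scan)
      (use rep_advance[of k "set_scalar ''x'' n s"] rep f c in \<open>simp_all add: rep_set_scalar\<close>)
  have reveal: "rval S adj (reveal_exp \<delta>) s = reveal w"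
    by (simp add: reveal_exp_def reveal_def top_entry_def rep')
  note p = reveal_bounds(1,2)[of w]
  show ?thesis
  proof (cases "?u \<in> pinned P")
    case True
    have 2: "config_val (set_scalar ''f'' 2 (set_scalar ''x'' n s)) (check_val (ghosts fs) Q w ?k c i P)" for n
      by (rule config_check) (use rep c i True in \<open>simp_all add: rep_set_scalar\<close>)
    have pos: "arrays s ''pos'' ?u 0 < length P" "arrays s ''trail'' (arrays s ''pos'' ?u 0) 0 = ?u"
      using trail_rep_pinned[OF rep'(10)] True by blast+
    have val: "40 * \<kappa> + (1 - reveal w) * ?scan (Suc i) P + reveal w * check_val (ghosts fs) Q w ?k c i P \<le> ?scan i P"
      using scan_val_pinned[OF rep'(8) c i(1) rep'(9) i(2) True] by (simp add: K_mult)
    have sum: "reveal w * (10 * \<kappa> + check_val (ghosts fs) Q w ?k c i P) +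
        (1 - reveal w) * (10 * \<kappa> + ?scan (Suc i) P) \<le> ?scan i P - 8 * \<kappa>"
      using val \<kappa> by (simp add: algebra_simps)
    show ?thesis
      using i
      apply (simp add: body_def scan_def f rep' top_entry_def next_nb_def advance_def reveal pinned_test_def pos
          del: nn_integral_bernoulli_pmf)
      apply (intro bounded_by_add \<kappa>)
      apply (rule bounded_by_bernoulli[where ?y1.0 = "10 * \<kappa> + check_val (ghosts fs) Q w ?k c i P" and
          ?y0.0 = "10 * \<kappa> + ?scan (Suc i) P"])
      subgoal using \<kappa> by (simp add: rep' pos) (intro bounded_by_add \<kappa>, rule bounded_by_potential[OF 2], simp)
      subgoal using \<kappa> by (simp add: rep') (intro bounded_by_add \<kappa>, rule bounded_by_potential[OF 1], simp)
      subgoal using p by simp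
      subgoal using p by simp
      subgoal using sum by simp
      done
  next
    case False
    let ?c = "call_val (insert w (ghosts fs)) P ?u (return_val ((w, c, i, Q) # fs) P ?u)"
    have "return_val ((w, c, i, Q) # fs) P ?u = (\<lambda>d. check_val (ghosts fs) Q w ?k c i (P @ [(?u, d)]))"
      by (simp add: fun_eq_iff)
    then have val: "40 * \<kappa> + (1 - reveal w) * ?scan (Suc i) P + reveal w * ?c \<le> ?scan i P"
      using scan_val_free[OF rep'(8) c i(1) rep'(9) refl i(2) False, of Q ?k]
      by (simp add: K_mult del: return_val.simps)
    \<comment> \<open>Eight steps lead up to and include the coin; 15 more suffice after either
      outcome.\<close>
    have sum: "reveal w * (15 * \<kappa> + ?c) + (1 - reveal w) * (15 * \<kappa> + ?scan (Suc i) P) \<le> ?scan i P - 8 * \<kappa>"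
      using val \<kappa> by (simp add: algebra_simps del: return_val.simps)
    have pos: "\<not> (arrays s ''pos'' ?u 0 < length P \<and> arrays s ''trail'' (arrays s ''pos'' ?u 0) 0 = ?u)"
      using trail_rep_pinned[OF rep'(10)] False by blast
    have rep1: "rep k (set_scalar ''x'' 1 s) ((w, c, i, Q) # fs) P" using rep by (simp add: rep_set_scalar)
    have call: "bounded_by (ec (call next_nb) potential (set_scalar ''x'' 1 s)) (15 * \<kappa> + ?c - \<kappa> - \<kappa>)"
      by (rule bounded_by_call[OF rep1, of ?u])
        (use i u c False \<kappa> in \<open>simp_all add: next_nb_def top_entry_def rep' del: return_val.simps\<close>)
    show ?thesis
      using i
      apply (simp add: body_def scan_def f rep' top_entry_def next_nb_def advance_def reveal
          del: nn_integral_bernoulli_pmf return_val.simps)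
      apply (intro bounded_by_add \<kappa>)
      apply (rule bounded_by_bernoulli[where ?y1.0 = "15 * \<kappa> + ?c" and ?y0.0 = "15 * \<kappa> + ?scan (Suc i) P"])
      subgoal
        apply (simp add: rep' pinned_test_def del: return_val.simps)
        apply (intro conjI impI)
        subgoal using pos by simp
        subgoal by (intro bounded_by_add \<kappa> call[unfolded next_nb_def top_entry_def One_nat_def])
        done
      subgoal using \<kappa> by (simp add: rep') (intro bounded_by_add \<kappa>, rule bounded_by_potential[OF 1], simp)
      subgoal using p by simp
      subgoal using p by simp
      subgoal using sum by (simp del: return_val.simps)
      done
  qed
qed

section \<open>From the potential to the cost of the whole program\<close>

lemma le_potentialI: "(\<And>x. config_val s x \<Longrightarrow> X \<le> ennreal x) \<Longrightarrow> X \<le> potential s"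
  unfolding potential_def by (intro INF_greatest) simp

lemma step_config_val:
  assumes "config_val s x" "scalars s ''k'' < scalars s ''m''"
  shows "bounded_by (ennreal \<kappa> + ec (body \<delta>) potential s) x"
  using assms
proof (induction rule: config_val.induct)
  case (config_main k s P)
  then show ?case by (intro step_main) (auto simp: rep_def)
next
  case (config_call k s w c i Q fs P)
  then show ?case by (intro step_call)
next
  case (config_scan k s w c i Q fs P)
  show ?case
  proof (cases "i < length (adj w)")
    case True
    then show ?thesis
      using step_ghost step_visit config_scan(1-3) by blast
  next
    case False
    then show ?thesis using step_return config_scan(1-3) by (meson not_le)
  qed
next
  case (config_check k s w c i Q fs P)
  then show ?case by (intro step_check)
qed

text \<open>The bottom frame is working on input vertex number \<open>k\<close>, so the loop cannot
  stop while a call is pending.\<close>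

lemma stack_ok_root_less: "stack_ok k fs P \<Longrightarrow> fs \<noteq> [] \<Longrightarrow> k < length xs"
proof (induction k fs P rule: stack_ok.induct)
  case (2 k v c i Q fs P)
  then show ?case by (cases fs) auto
qed simp

text \<open>At the exit the stack is empty and all of \<open>xs\<close> is pinned, so the
  conditional expectation has collapsed to \<open>f\<close> of the output.\<close>

lemma final_config_val:
  assumes "config_val s x" "\<not> scalars s ''k'' < scalars s ''m''"
  shows "\<kappa> + f (output_config (set xs) s) \<le> x"
  using assms
proof (induction rule: config_val.induct)
  case (config_main k s P)
  have rep: "rep k s [] P" and k: "k = length xs" using config_main by (auto simp: rep_def)
  have P: "map fst P = xs" using rep k by (simp add: rep_def)
  have pinned: "pinned P = set xs" unfolding pinned_def P[symmetric] by simp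
  have len: "length P = length xs" using arg_cong[OF P, of length] by simp
  have "restrict (pin_val P) (set xs) = output_config (set xs) s"
    using rep trail_rep_output[of s P] pinned
    by (auto simp: output_config_def restrict_def rep_def fun_eq_iff)
  moreover have "ok_pins P" using rep by (simp add: rep_def)
  ultimately show ?case
    using cond_exp_all_pinned[of "set xs" P f] pinned xs len by (simp add: main_val_def)
qed (use stack_ok_root_less in \<open>(fastforce simp: rep_def)+\<close>)

lemma expected_cost_sampler_le:
  "expected_cost S adj (ennreal \<kappa>) (sampler \<delta>) (\<lambda>s. ennreal (f (output_config (set xs) s)))
     (input_state S xs) \<le> ennreal (main_val [])"
proof -
  have "ec (sampler \<delta>) (\<lambda>s. ennreal (f (output_config (set xs) s))) (input_state S xs)
      \<le> potential (input_state S xs)"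
    unfolding sampler_def
  proof (rule expected_cost_While_le)
    fix s assume "bval S adj (Less (V ''k'') (V ''m'')) s"
    then show "ennreal \<kappa> + ec (body \<delta>) potential s \<le> potential s"
      using step_config_val by (intro le_potentialI) (auto simp: bounded_by_def)
  next
    fix s assume s: "\<not> bval S adj (Less (V ''k'') (V ''m'')) s"
    show "ennreal \<kappa> + ennreal (f (output_config (set xs) s)) \<le> potential s"
      by (intro le_potentialI)
        (use s final_config_val \<kappa> f in \<open>auto simp flip: ennreal_plus intro!: ennreal_leI\<close>)
  qed
  moreover have "rep 0 (input_state S xs) [] []"
    by (simp add: rep_def input_state_def trail_rep_def)
  then have "potential (input_state S xs) \<le> ennreal (main_val [])"
    using bounded_by_potential config_main by (meson bounded_by_def order_refl)
  ultimately show ?thesis by (rule order_trans)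
qed

end

section \<open>Choice of constants and the two uses of the potential\<close>

theorem theorem1p2:
  fixes \<delta> :: real
  assumes "\<delta> > 0"
  shows "\<exists>(P :: com) (C :: real).
    \<forall>(S :: spin_system) (adj :: nat \<Rightarrow> nat list) (\<Lambda> :: nat set) (xs :: nat list).
      wf_spin_system S \<and> adjacency_lists S adj \<and> max_degree S \<ge> 1 \<and>
      normalized S \<and> soft_constraints \<delta> S \<and>
      \<Lambda> \<subseteq> verts S \<and> distinct xs \<and> set xs = \<Lambda> \<longrightarrow>
        (\<forall>\<tau>\<in>configs S \<Lambda>. output_prob P S adj xs \<tau> = gibbs_marginal S \<Lambda> \<tau>) \<and>
        expected_time P S adj xs
          \<le> ennreal (C * real (max_degree S) * log 2 (real (spins S)) * real (max 1 (card \<Lambda>)))"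
proof -
  \<comment> \<open>The analysis needs a parameter below 1; decreasing \<delta> only weakens the
    soft constraints.\<close>
  define \<delta>' where "\<delta>' = min \<delta> (1 / 2)"
  have \<delta>': "0 < \<delta>'" "\<delta>' < 1" "\<delta>' \<le> \<delta>" using assms by (auto simp: \<delta>'_def)
  \<comment> \<open>With 4 K = 160, \<open>T\<close> is at most 161 \<Delta> log q / \<delta>'. The
    41 covers one loop execution per vertex and the final loop test.\<close>
  define C where "C = 161 / \<delta>' + 41"
  have main: "(\<forall>\<tau>\<in>configs S (set xs). output_prob (sampler \<delta>') S adj xs \<tau> = gibbs_marginal S (set xs) \<tau>) \<and>
        expected_time (sampler \<delta>') S adj xs
          \<le> ennreal (C * real (max_degree S) * log 2 (real (spins S)) * real (max 1 (card (set xs))))"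
    if S: "wf_spin_system S" "adjacency_lists S adj" "max_degree S \<ge> 1" "normalized S" "soft_constraints \<delta> S"
      and xs: "distinct xs" "set xs \<subseteq> verts S"
    for S :: spin_system and adj :: "nat \<Rightarrow> nat list" and xs :: "nat list"
  proof -
    have soft: "soft_constraints \<delta>' S"
    proof -
      have "(1 - \<delta>) / (2 * real (max_degree S)) \<le> (1 - \<delta>') / (2 * real (max_degree S))"
        using \<delta>' S(3) by (intro divide_right_mono) auto
      then show ?thesis using S(5) unfolding soft_constraints_def by fastforce
    qed
    have sampler: "soft_sampler S adj \<delta>' \<kappa> f xs" if "\<kappa> \<ge> 0" "\<And>\<tau>. f \<tau> \<ge> 0" for \<kappa> f
      using S soft xs \<delta>' that by unfold_locales auto
    interpret time: soft_sampler S adj \<delta>' 1 "\<lambda>_. 0" xs by (rule sampler) auto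
    have time: "expected_time (sampler \<delta>') S adj xs \<le> ennreal (time.main_val [])"
      using expected_time_le[of "sampler \<delta>'" S adj xs] time.expected_cost_sampler_le by simp
    have "time.main_val [] \<le> C * real (max_degree S) * log 2 (real (spins S)) * real (max 1 (card (set xs)))"
    proof -
      let ?D = "real (max_degree S)" and ?l = "log 2 (real (spins S))" and ?n = "real (max 1 (card (set xs)))"
      have D: "1 \<le> ?D" and l: "1 \<le> ?l" and n: "1 \<le> ?n" "real (length xs) \<le> ?n"
        using S(3) time.log_q distinct_card[OF xs(1)] by auto
      have Dl: "1 \<le> ?D * ?l" "?D \<le> ?D * ?l" "?l \<le> ?D * ?l"
        using mult_mono[OF D l] mult_left_mono[OF l, of ?D] mult_right_mono[OF D, of ?l] D l by auto
      have "time.T \<le> 161 * (?D * ?l) / \<delta>'"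
        unfolding time.T_def time.K_def using \<delta>' Dl by (intro divide_right_mono) auto
      then have "time.T + 40 + 1 \<le> C * (?D * ?l)"
        using Dl by (simp add: C_def algebra_simps)
      then have "(time.T + 40 + 1) * ?n \<le> C * (?D * ?l) * ?n"
        using n by (intro mult_right_mono) auto
      \<comment> \<open>The cost of the final loop test is absorbed by \<open>?n \<ge> 1\<close>;
        for an empty \<open>xs\<close> this relies on the maximum with 1.\<close>
      moreover have "time.main_val [] \<le> ?n * (time.T + 40) + ?n"
      proof -
        have "real (length xs) * (time.T + 40) \<le> ?n * (time.T + 40)"
          using time.T_nonneg n(2) by (intro mult_right_mono) auto
        moreover have "time.main_val [] = real (length xs) * (time.T + 40) + 1"
          by (simp add: time.main_val_def time.K_def time.cond_exp_const)
        ultimately show ?thesis using n(1) by linarith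
      qed
      ultimately show ?thesis by (simp add: algebra_simps)
    qed
    then have le: "expected_time (sampler \<delta>') S adj xs
        \<le> ennreal (C * real (max_degree S) * log 2 (real (spins S)) * real (max 1 (card (set xs))))"
      using time by (meson ennreal_leI order_trans)
    then have fin: "expected_time (sampler \<delta>') S adj xs < \<infinity>"
      by (metis ennreal_less_top infinity_ennreal_def order_le_less_trans)
    have [simp]: "ennreal (of_bool b) = of_bool b" for b by (cases b) simp_all
    have "output_prob (sampler \<delta>') S adj xs \<tau> = gibbs_marginal S (set xs) \<tau>" for \<tau>
    proof (rule output_prob_eqI[OF time.q fin _ _ time.gibbs_marginal_bounds[OF xs(2)]])
      \<comment> \<open>With time priced at 0, the indicators of \<tau> and of its complement give
        the two upper bounds that determine the output probability.\<close>
      interpret eq: soft_sampler S adj \<delta>' 0 "\<lambda>\<sigma>. of_bool (\<sigma> = \<tau>)" xs by (rule sampler) auto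
      show "expected_cost S adj 0 (sampler \<delta>') (\<lambda>s. of_bool (output_config (set xs) s = \<tau>)) (input_state S xs)
          \<le> ennreal (gibbs_marginal S (set xs) \<tau>)"
        using eq.expected_cost_sampler_le by (simp add: eq.main_val_def time.cond_exp_gibbs[OF xs(2)])
      interpret neq: soft_sampler S adj \<delta>' 0 "\<lambda>\<sigma>. of_bool (\<sigma> \<noteq> \<tau>)" xs by (rule sampler) auto
      show "expected_cost S adj 0 (sampler \<delta>') (\<lambda>s. of_bool (output_config (set xs) s \<noteq> \<tau>)) (input_state S xs)
          \<le> ennreal (1 - gibbs_marginal S (set xs) \<tau>)"
        using neq.expected_cost_sampler_le
        by (simp add: neq.main_val_def time.cond_exp_gibbs_compl[OF xs(2), simplified])
    qed
    then show ?thesis using le by blast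
  qed
  show ?thesis
    by (rule exI[of _ "sampler \<delta>'"], rule exI[of _ C]) (use main in blast)
qed

end
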